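(* Let $k$ be a field of characteristic zero and let $A$ be a standard graded artinian level $k$-algebra of codimension $3$, socle degree $c$ and multiplicity $e$. Let $t,i,j,m$ be the integers attached to the $h$-vector of $A$ as defined in the context, and for $l=1,2,3$ let $m_l$ and $M_l$ be respectively the smallest and the largest shift appearing in the $l$-th module $F_l$ of the minimal free resolution of $A$. Then: (a) if $\dfrac{t\cdot i\cdot (c+3)}{6}\le e$, then $\dfrac{m_1m_2m_3}{6}\le e$; (b) if $e\le \dfrac{m\cdot j\cdot (c+3)}{6}$, then $e\le \dfrac{M_1M_2M_3}{6}$.
   Context: $k$ is a field of characteristic zero, $R=k[x_1,x_2,x_3]$ with all $x_i$ of degree $1$, and $A=R/I$ is artinian with $I$ a homogeneous ideal containing no nonzero form of degree $1$. The $h$-vector of $A$ is $h(A)=(h_0,h_1,\dots,h_c)$, $h_i=\dim_k A_i$, where $c$ (the socle degree) is the last index with $A_c\ne0$; the codimension is $h_1=3$ and the multiplicity is $e=h_0+\dots+h_c=\dim_k A$. $A$ is level if its socle $\{a\in A: a\overline m=0\}$ ($\overline m$ the maximal homogeneous ideal of $A$) is concentrated in degree $c$. The graded minimal free resolution of $A$ over $R$ is $0\to F_3\to F_2\to F_1\to R\to R/I\to 0$ with $F_l=\bigoplus_d R^{\beta_{l,d}}(-d)$; the shifts appearing in $F_l$ are the integers $d$ with $\beta_{l,d}>0$. Set $h_n=0$ for $n<0$ and for $n>c$, and for every integer $n$ put $$f(n)=h_n-3h_{n-1}+3h_{n-2}-h_{n-3}.$$ Let $t$ be the initial degree of $I$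 (the least degree in which $I$ is nonzero; equivalently the smallest integer with $f(t)<0$); let $i$ be the smallest positive integer such that $f(i)>0$; let $j$ be the largest integer such that $f(j)>0$; let $m$ be the largest integer lower than $c+3$ such that $f(m)<0$. *)

theory Defs
  imports
    Complex_Main
    "HOL-Library.Poly_Mapping"
    "HOL-Library.Numeral_Type"
    "HOL-Algebra.QuotRing"
    "HOL-Algebra.Embedded_Algebras"
    "HOL-Algebra.Algebraic_Closure_Type"
begin

section \<open>The polynomial ring in three variables\<close>

text \<open>A monomial is an exponent vector indexed by the three-element type \<^typ>\<open>3\<close>, and a
  polynomial is a finitely supported family of coefficients; multiplication is the convolution
  product of \<^theory>\<open>HOL-Library.Poly_Mapping\<close>.\<close>

type_synonym 'k poly3 = "(3 \<Rightarrow>\<^sub>0 nat) \<Rightarrow>\<^sub>0 'k"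

abbreviation R3 :: "'k::field_char_0 poly3 ring"
  where "R3 \<equiv> ring_of_type_algebra"

definition mdeg :: "(3 \<Rightarrow>\<^sub>0 nat) \<Rightarrow> nat"
  where "mdeg \<alpha> = (\<Sum>v\<in>UNIV. Poly_Mapping.lookup \<alpha> v)"

text \<open>Degrees are integers, so that \<open>forms d = {0}\<close> for \<open>d < 0\<close>. The zero polynomial is a
  form of every degree.\<close>

definition forms :: "int \<Rightarrow> 'k::field_char_0 poly3 set"
  where "forms d = {p. \<forall>\<alpha>\<in>Poly_Mapping.keys p. int (mdeg \<alpha>) = d}"

definition hom_component :: "int \<Rightarrow> 'k::field_char_0 poly3 \<Rightarrow> 'k poly3"
  where "hom_component d p =
    (\<Sum>\<alpha> | \<alpha> \<in> Poly_Mapping.keys p \<and> int (mdeg \<alpha>) = d. Poly_Mapping.single \<alpha> (Poly_Mapping.lookup p \<alpha>))"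

definition constants :: "'k::field_char_0 poly3 set"
  where "constants = {Poly_Mapping.single 0 a | a. True}"

definition irrelevant_ideal :: "'k::field_char_0 poly3 set"
  where "irrelevant_ideal = {p. Poly_Mapping.lookup p 0 = 0}"

definition homogeneous_ideal :: "'k::field_char_0 poly3 set \<Rightarrow> bool"
  where "homogeneous_ideal I \<longleftrightarrow> ideal I R3 \<and> (\<forall>p\<in>I. \<forall>d. hom_component d p \<in> I)"

section \<open>The quotient algebra\<close>

abbreviation quot_alg :: "'k::field_char_0 poly3 set \<Rightarrow> 'k poly3 set ring"
  where "quot_alg I \<equiv> R3 Quot I"

abbreviation residue :: "'k::field_char_0 poly3 set \<Rightarrow> 'k poly3 \<Rightarrow> 'k poly3 set"
  where "residue I p \<equiv> I +>\<^bsub>R3\<^esub> p"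

definition artinian :: "('a, 'b) ring_scheme \<Rightarrow> bool"
  where "artinian A \<longleftrightarrow>
    (\<forall>J :: nat \<Rightarrow> 'a set. (\<forall>n. ideal (J n) A) \<and> decseq J \<longrightarrow> (\<exists>N. \<forall>n\<ge>N. J n = J N))"

definition quot_part :: "'k::field_char_0 poly3 set \<Rightarrow> int \<Rightarrow> 'k poly3 set set"
  where "quot_part I d = residue I ` forms d"

text \<open>The dimension is taken over the copy of the ground field inside the quotient. Since
  \<open>forms n = {0}\<close> for \<open>n < 0\<close>, the convention \<open>h\<^sub>n = 0\<close> for \<open>n < 0\<close> is built in, and likewise
  \<open>h\<^sub>n = 0\<close> beyond the socle degree, where the graded part is zero.\<close>

definition hilb :: "'k::field_char_0 poly3 set \<Rightarrow> int \<Rightarrow> nat"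
  where "hilb I n = ring.dim (quot_alg I) (residue I ` constants) (quot_part I n)"

definition third_diff :: "'k::field_char_0 poly3 set \<Rightarrow> int \<Rightarrow> int"
  where "third_diff I n =
    int (hilb I n) - 3 * int (hilb I (n - 1)) + 3 * int (hilb I (n - 2)) - int (hilb I (n - 3))"

definition socle_degree :: "'k::field_char_0 poly3 set \<Rightarrow> nat \<Rightarrow> bool"
  where "socle_degree I c \<longleftrightarrow>
    quot_part I (int c) \<noteq> {\<zero>\<^bsub>quot_alg I\<^esub>} \<and>
    (\<forall>n > int c. quot_part I n = {\<zero>\<^bsub>quot_alg I\<^esub>})"

definition socle :: "'k::field_char_0 poly3 set \<Rightarrow> 'k poly3 set set"
  where "socle I = {a \<in> carrier (quot_alg I).
    \<forall>b \<in> residue I ` irrelevant_ideal. a \<otimes>\<^bsub>quot_alg I\<^esub> b = \<zero>\<^bsub>quot_alg I\<^esub>}"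

definition level :: "'k::field_char_0 poly3 set \<Rightarrow> nat \<Rightarrow> bool"
  where "level I c \<longleftrightarrow> socle I \<subseteq> quot_part I (int c)"

section \<open>Minimal graded free resolutions\<close>

text \<open>The graded free module \<open>\<Oplus>\<^sub>a R(-ds ! a)\<close> is represented by the list \<open>ds\<close> of its shifts.
  Its elements are the families supported on \<open>{..<length ds}\<close>.\<close>

definition free_module :: "int list \<Rightarrow> (nat \<Rightarrow> 'k::field_char_0 poly3) set"
  where "free_module ds = {v. \<forall>a \<ge> length ds. v a = 0}"

definition mat_apply :: "int list \<Rightarrow> int list \<Rightarrow> (nat \<Rightarrow> nat \<Rightarrow> 'k::field_char_0 poly3) \<Rightarrow>
    (nat \<Rightarrow> 'k poly3) \<Rightarrow> (nat \<Rightarrow> 'k poly3)"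
  where "mat_apply es ds M v =
    (\<lambda>a. if a < length es then \<Sum>b<length ds. M a b * v b else 0)"

text \<open>A matrix defines a homomorphism \<open>\<Oplus>\<^sub>b R(-ds ! b) \<rightarrow> \<Oplus>\<^sub>a R(-es ! a)\<close> of degree zero iff its
  entry in row \<open>a\<close> and column \<open>b\<close> is a form of degree \<open>ds ! b - es ! a\<close>.\<close>

definition graded_matrix ::
    "int list \<Rightarrow> int list \<Rightarrow> (nat \<Rightarrow> nat \<Rightarrow> 'k::field_char_0 poly3) \<Rightarrow> bool"
  where "graded_matrix es ds M \<longleftrightarrow>
    (\<forall>a < length es. \<forall>b < length ds. M a b \<in> forms (ds ! b - es ! a))"

text \<open>\<open>D l\<close> lists the shifts of \<open>F\<^sub>l\<close>, with \<open>F\<^sub>0 = R\<close> and \<open>F\<^sub>4 = 0\<close>, so \<open>\<beta>\<^bsub>l,d\<^esub>\<close> is the number of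
  occurrences of \<open>d\<close> in \<open>D l\<close>; \<open>\<Phi> l\<close> is the matrix of \<open>F\<^sub>l \<rightarrow> F\<^sub>l\<^sub>-\<^sub>1\<close>. Exactness at \<open>F\<^sub>0\<close> says
  that the image of \<open>F\<^sub>1\<close> is \<open>I\<close>, the kernel of \<open>R \<rightarrow> R/I\<close>; exactness at \<open>F\<^sub>3\<close> says that
  \<open>F\<^sub>3 \<rightarrow> F\<^sub>2\<close> is injective. Minimality: \<open>F\<^sub>l\<close> is mapped into \<open>\<mm>F\<^sub>l\<^sub>-\<^sub>1\<close>, that is, all
  matrix entries lie in the irrelevant ideal.\<close>

definition minimal_resolution :: "'k::field_char_0 poly3 set \<Rightarrow> (nat \<Rightarrow> int list) \<Rightarrow>
    (nat \<Rightarrow> nat \<Rightarrow> nat \<Rightarrow> 'k poly3) \<Rightarrow> bool"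
  where "minimal_resolution I D \<Phi> \<longleftrightarrow>
    D 0 = [0] \<and> D 4 = [] \<and>
    (\<forall>l\<in>{1..3}. graded_matrix (D (l - 1)) (D l) (\<Phi> l)) \<and>
    mat_apply (D 0) (D 1) (\<Phi> 1) ` free_module (D 1) = {v \<in> free_module (D 0). v 0 \<in> I} \<and>
    (\<forall>l\<in>{1..3}. {v \<in> free_module (D l). mat_apply (D (l - 1)) (D l) (\<Phi> l) v = (\<lambda>_. 0)} =
       mat_apply (D l) (D (l + 1)) (\<Phi> (l + 1)) ` free_module (D (l + 1))) \<and>
    (\<forall>l\<in>{1..3}. \<forall>a < length (D (l - 1)). \<forall>b < length (D l). \<Phi> l a b \<in> irrelevant_ideal)"

definition min_shift :: "(nat \<Rightarrow> int list) \<Rightarrow> nat \<Rightarrow> int"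
  where "min_shift D l = Min (set (D l))"

definition max_shift :: "(nat \<Rightarrow> int list) \<Rightarrow> nat \<Rightarrow> int"
  where "max_shift D l = Max (set (D l))"

end

theory Submission
  imports Defs "HOL-Library.Function_Algebras"
begin

text \<open>Since the third difference of the Hilbert function of \<open>R\<close> is the indicator of \<open>0\<close>, the resolution
  gives \<open>f(n) = [n = 0] - \<beta>\<^bsub>1,n\<^esub> + \<beta>\<^bsub>2,n\<^esub> - \<beta>\<^bsub>3,n\<^esub>\<close>. Hence \<open>i\<close> and \<open>j\<close> are shifts of
  \<open>F\<^sub>2\<close>. The identification of \<open>Tor\<^sub>3(A, k)\<close> with the socle shows that levelness forces every shift of
  \<open>F\<^sub>3\<close> to be \<open>c + 3\<close>, so \<open>m\<close> must be a shift of \<open>F\<^sub>1\<close>; and \<open>c + 3\<close> does occur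
  because \<open>f(c + 3) = - h\<^sub>c < 0\<close> while no minimal generator has degree \<open>c + 3\<close>. Finally \<open>m\<^sub>1 \<le> t\<close>,
  and all shifts are positive, so both inequalities follow by multiplying.\<close>

section \<open>Polynomials in three variables\<close>

text \<open>The third difference sees only an alternating sum of Betti numbers, in which
  cancellation may hide shifts; only its sign is usable. A positive value at
  \<open>n \<noteq> 0\<close> forces a shift of \<open>F_2\<close>, a negative one forces a shift of
  \<open>F_1\<close> or \<open>F_3\<close>, and the bound on \<open>m\<close> serves to rule out the
  latter. Of the Tor identification, just the passage from a shift of \<open>F_3\<close> to a socle
  element is carried out, as an explicit diagram chase. The chase has to control degrees, so its
  Koszul preimages are produced by coefficient formulas, namely division by an indeterminate, rather
  than chosen. Two gaps must be bridged before dimensions can be counted. Exactness of the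
  resolution speaks of arbitrary families, while the count needs it degree by degree; homogeneous
  components turn any preimage into a graded one. The Hilbert function is a dimension over a field
  embedded in the quotient ring, while rank-nullity lives in vector spaces over \<open>k\<close>; a
  complement of \<open>I_n\<close> in \<open>R_n\<close> connects the two.\<close>

lemma lookup_single_mult:
  "Poly_Mapping.lookup (Poly_Mapping.single a c * p) k =
     c * (\<Sum>q. Poly_Mapping.lookup p q when k = a + q)"
  for p :: "'k::field_char_0 poly3"
proof -
  have "Poly_Mapping.lookup (Poly_Mapping.single a c * p) k =
      (\<Sum>l. (c * (\<Sum>q. Poly_Mapping.lookup p q when k = l + q)) when a = l)"
    by (simp add: lookup_mult lookup_single when_mult)
  then show ?thesis by simp
qed

lemma lookup_const_mult [simp]:
  "Poly_Mapping.lookup (Poly_Mapping.single 0 c * p) k = c * Poly_Mapping.lookup p k"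
  for p :: "'k::field_char_0 poly3"
  by (simp add: lookup_single_mult)

section \<open>Indeterminates and division with remainder by them\<close>

definition indet :: "3 \<Rightarrow> 'k::field_char_0 poly3"
  where "indet v = Poly_Mapping.single (Poly_Mapping.single v 1) 1"

lemma indet_neq_0 [simp]: "indet v \<noteq> 0"
  unfolding indet_def by (metis lookup_single_eq lookup_zero zero_neq_one)

lemma mdeg_0 [simp]: "mdeg 0 = 0"
  and mdeg_add [simp]: "mdeg (\<alpha> + \<beta>) = mdeg \<alpha> + mdeg \<beta>"
  and mdeg_single [simp]: "mdeg (Poly_Mapping.single v n) = n"
  by (simp_all add: mdeg_def lookup_add sum.distrib lookup_single when_def)

lemma mdeg_eq_0_iff [simp]: "mdeg \<alpha> = 0 \<longleftrightarrow> \<alpha> = 0"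
  by (auto simp: mdeg_def intro!: poly_mapping_eqI)

lemma lookup_indet_mult_shift [simp]:
  "Poly_Mapping.lookup (indet v * p) (Poly_Mapping.single v (Suc 0) + \<alpha>) = Poly_Mapping.lookup p \<alpha>"
  for p :: "'k::field_char_0 poly3"
  by (simp add: indet_def lookup_single_mult)

lemma lookup_indet_mult_eq_0:
  "Poly_Mapping.lookup \<alpha> v = 0 \<Longrightarrow> Poly_Mapping.lookup (indet v * p) \<alpha> = 0"
  for p :: "'k::field_char_0 poly3"
proof -
  assume "Poly_Mapping.lookup \<alpha> v = 0"
  then have "\<alpha> \<noteq> Poly_Mapping.single v 1 + q" for q
    by (auto simp: lookup_add)
  then show ?thesis by (simp add: indet_def lookup_single_mult)
qed

lemma exponent_cases:
  obtains "Poly_Mapping.lookup \<alpha> v = 0" | \<beta> where "\<alpha> = Poly_Mapping.single v (1::nat) + \<beta>"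
proof (cases "Poly_Mapping.lookup \<alpha> v = 0")
  case False
  have "\<alpha> = Poly_Mapping.single v 1 + (\<alpha> - Poly_Mapping.single v 1)"
    using False by (intro poly_mapping_eqI) (auto simp: lookup_add lookup_minus lookup_single when_def)
  then show ?thesis using that(2) by blast
qed (use that(1) in blast)

text \<open>Quotient and remainder modulo one indeterminate, the remainder being free of it. Both
  are operations on coefficients: the quotient lowers the degree of a form by one and the remainder
  keeps it, so witnesses built from them are graded automatically.\<close>

definition div_indet :: "3 \<Rightarrow> 'k::field_char_0 poly3 \<Rightarrow> 'k poly3"
  where "div_indet v p = Poly_Mapping.map_key ((+) (Poly_Mapping.single v 1)) p"

definition mod_indet :: "3 \<Rightarrow> 'k::field_char_0 poly3 \<Rightarrow> 'k poly3"
  where "mod_indet v p = Poly_Mapping.mapp (\<lambda>\<alpha> x. x when Poly_Mapping.lookup \<alpha> v = 0) p"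

lemma lookup_div_indet [simp]:
  "Poly_Mapping.lookup (div_indet v p) \<alpha> = Poly_Mapping.lookup p (Poly_Mapping.single v (Suc 0) + \<alpha>)"
  by (simp add: div_indet_def map_key.rep_eq inj_def)

lemma lookup_mod_indet [simp]:
  "Poly_Mapping.lookup (mod_indet v p) \<alpha> =
    (Poly_Mapping.lookup p \<alpha> when Poly_Mapping.lookup \<alpha> v = 0)"
  by (auto simp add: mod_indet_def lookup_mapp when_def in_keys_iff)

lemma div_mod_indet: "p = indet v * div_indet v p + mod_indet v p"
proof (rule poly_mapping_eqI)
  fix \<alpha>
  show "Poly_Mapping.lookup p \<alpha> = Poly_Mapping.lookup (indet v * div_indet v p + mod_indet v p) \<alpha>"
    by (cases rule: exponent_cases[of \<alpha> v]) (simp_all add: lookup_add lookup_indet_mult_eq_0)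
qed

lemma div_indet_0 [simp]: "div_indet v 0 = 0" and mod_indet_0 [simp]: "mod_indet v 0 = 0"
  by (auto intro!: poly_mapping_eqI simp: when_def)

lemma div_indet_indet_mult [simp]: "div_indet v (indet v * p) = p"
  by (rule poly_mapping_eqI) simp

lemma mod_indet_add: "mod_indet v (p + q) = mod_indet v p + mod_indet v q"
  by (rule poly_mapping_eqI) (simp add: lookup_add when_def)

lemma mod_indet_indet_mult_same [simp]: "mod_indet v (indet v * p) = 0"
  by (rule poly_mapping_eqI) (simp add: when_def lookup_indet_mult_eq_0)

lemma mod_indet_indet_mult:
  assumes "v \<noteq> w"
  shows "mod_indet w (indet v * p) = indet v * mod_indet w p"
proof (rule poly_mapping_eqI)
  fix \<alpha>
  show "Poly_Mapping.lookup (mod_indet w (indet v * p)) \<alpha> = Poly_Mapping.lookup (indet v * mod_indet w p) \<alpha>"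
    using assms
    by (cases rule: exponent_cases[of \<alpha> v])
      (auto simp add: lookup_indet_mult_eq_0 when_def lookup_add lookup_single)
qed

text \<open>Two distinct indeterminates form a regular sequence: reducing the equation modulo
  \<open>indet w\<close> leaves \<open>indet v * mod_indet w p = 0\<close>, and the polynomial ring
  has no zero divisors.\<close>

lemma indet_mult_dvd:
  assumes "v \<noteq> w" and "indet v * p = indet w * q"
  shows "p = indet w * div_indet w p"
proof -
  have "indet v * mod_indet w p = 0"
    using assms mod_indet_indet_mult[OF assms(1), of p] by simp
  then show ?thesis using div_mod_indet[of p w] by simp
qed

section \<open>Forms\<close>

lemma formsI: "(\<And>\<alpha>. Poly_Mapping.lookup p \<alpha> \<noteq> 0 \<Longrightarrow> int (mdeg \<alpha>) = d) \<Longrightarrow> p \<in> forms d"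
  by (simp add: forms_def in_keys_iff)

lemma formsD: "p \<in> forms d \<Longrightarrow> Poly_Mapping.lookup p \<alpha> \<noteq> 0 \<Longrightarrow> int (mdeg \<alpha>) = d"
  by (simp add: forms_def in_keys_iff)

lemma zero_in_forms [simp]: "0 \<in> forms d"
  by (simp add: forms_def)

lemma forms_add: "p \<in> forms d \<Longrightarrow> q \<in> forms d \<Longrightarrow> p + q \<in> forms d"
  by (rule formsI) (metis add.right_neutral formsD lookup_add)

lemma forms_minus: "p \<in> forms d \<Longrightarrow> - p \<in> forms d"
  by (rule formsI) (simp add: formsD)

lemma forms_sum: "(\<And>b. b \<in> B \<Longrightarrow> f b \<in> forms d) \<Longrightarrow> sum f B \<in> forms d"
  by (induction B rule: infinite_finite_induct) (auto intro: forms_add)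

lemma forms_mult: "p \<in> forms d \<Longrightarrow> q \<in> forms d' \<Longrightarrow> p * q \<in> forms (d + d')"
  using keys_mult[of p q] by (fastforce simp: forms_def)

lemma indet_in_forms: "indet v \<in> forms 1"
  by (auto simp: indet_def intro!: formsI simp: lookup_single when_def split: if_splits)

lemma const_in_forms: "Poly_Mapping.single 0 a \<in> forms 0"
  by (auto intro!: formsI simp: lookup_single when_def split: if_splits)

lemma const_mult_in_forms: "p \<in> forms d \<Longrightarrow> Poly_Mapping.single 0 a * p \<in> forms d"
  using forms_mult[OF const_in_forms[of a], of p d] by simp

lemma div_indet_in_forms: "p \<in> forms d \<Longrightarrow> div_indet v p \<in> forms (d - 1)"
  by (rule formsI) (fastforce dest: formsD)

lemma mod_indet_in_forms: "p \<in> forms d \<Longrightarrow> mod_indet v p \<in> forms d"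
  by (rule formsI) (auto dest: formsD simp: when_def split: if_splits)

lemma forms_neg: "p \<in> forms d \<Longrightarrow> d < 0 \<Longrightarrow> p = 0"
  by (rule poly_mapping_eqI) (use formsD in fastforce)

lemma forms_0_irrelevant: "p \<in> forms 0 \<Longrightarrow> p \<in> irrelevant_ideal \<Longrightarrow> p = 0"
  by (rule poly_mapping_eqI) (use formsD in \<open>fastforce simp: irrelevant_ideal_def\<close>)

lemma lookup_hom_component [simp]:
  "Poly_Mapping.lookup (hom_component d p) \<alpha> = (Poly_Mapping.lookup p \<alpha> when int (mdeg \<alpha>) = d)"
  by (auto simp: hom_component_def lookup_sum lookup_single when_def in_keys_iff sum.delta)

lemma hom_component_in_forms: "hom_component d p \<in> forms d"
  by (rule formsI) (auto simp: when_def split: if_splits)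

lemma hom_component_forms: "p \<in> forms d \<Longrightarrow> hom_component d p = p"
  by (rule poly_mapping_eqI) (use formsD in \<open>fastforce simp: when_def\<close>)

lemma hom_component_forms_other: "p \<in> forms d' \<Longrightarrow> d \<noteq> d' \<Longrightarrow> hom_component d p = 0"
  by (rule poly_mapping_eqI) (use formsD in \<open>fastforce simp: when_def\<close>)

lemma hom_component_0 [simp]: "hom_component d 0 = 0"
  by (rule poly_mapping_eqI) simp

lemma hom_component_add: "hom_component d (p + q) = hom_component d p + hom_component d q"
  by (rule poly_mapping_eqI) (simp add: lookup_add when_def)

lemma hom_component_diff: "hom_component d (p - q) = hom_component d p - hom_component d q"
  by (rule poly_mapping_eqI) (simp add: lookup_minus when_def)

lemma hom_component_sum: "hom_component d (sum f B) = (\<Sum>b\<in>B. hom_component d (f b))"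
  by (induction B rule: infinite_finite_induct) (auto simp: hom_component_add)

text \<open>Removing from \<open>q\<close> its component of degree \<open>d' - d\<close> leaves a
  polynomial \<open>r\<close> without monomials of that degree; hence \<open>p * r\<close> has none
  of degree \<open>d'\<close>.\<close>

lemma hom_component_mult:
  assumes p: "p \<in> forms d"
  shows "hom_component d' (p * q) = p * hom_component (d' - d) q"
proof -
  define r where "r = q - hom_component (d' - d) q"
  have r: "int (mdeg \<alpha>) \<noteq> d' - d" if "\<alpha> \<in> Poly_Mapping.keys r" for \<alpha>
    using that by (auto simp: r_def in_keys_iff lookup_minus when_def)
  have "hom_component d' (p * r) = 0"
  proof (rule poly_mapping_eqI)
    fix \<alpha>
    have "int (mdeg \<alpha>) \<noteq> d'" if "\<alpha> \<in> Poly_Mapping.keys (p * r)"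
      using that keys_mult[of p r] p r by (fastforce simp: forms_def)
    then show "Poly_Mapping.lookup (hom_component d' (p * r)) \<alpha> = Poly_Mapping.lookup 0 \<alpha>"
      by (auto simp: when_def in_keys_iff)
  qed
  moreover have "hom_component d' (p * hom_component (d' - d) q) = p * hom_component (d' - d) q"
    using forms_mult[OF p hom_component_in_forms[of "d' - d" q]] by (simp add: hom_component_forms)
  moreover have "p * q = p * hom_component (d' - d) q + p * r"
    by (simp add: r_def algebra_simps)
  ultimately show ?thesis by (simp add: hom_component_add)
qed

lemma irrelevant_ideal_zero [simp]: "0 \<in> irrelevant_ideal"
  by (simp add: irrelevant_ideal_def)

lemma irrelevant_ideal_add:
  "p \<in> irrelevant_ideal \<Longrightarrow> q \<in> irrelevant_ideal \<Longrightarrow> p + q \<in> irrelevant_ideal"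
  by (simp add: irrelevant_ideal_def lookup_add)

lemma irrelevant_ideal_sum:
  "(\<And>b. b \<in> B \<Longrightarrow> f b \<in> irrelevant_ideal) \<Longrightarrow> sum f B \<in> irrelevant_ideal"
  by (induction B rule: infinite_finite_induct) (auto intro: irrelevant_ideal_add)

lemma irrelevant_ideal_mult: "p \<in> irrelevant_ideal \<Longrightarrow> p * q \<in> irrelevant_ideal"
proof -
  assume p: "p \<in> irrelevant_ideal"
  have "0 \<notin> Poly_Mapping.keys (p * q)"
  proof
    assume "0 \<in> Poly_Mapping.keys (p * q)"
    then obtain a b where "0 = a + b" "a \<in> Poly_Mapping.keys p"
      using keys_mult[of p q] by blast
    then have "mdeg a + mdeg b = 0" by (metis mdeg_0 mdeg_add)
    then have "a = 0" by simp
    then show False using p \<open>a \<in> Poly_Mapping.keys p\<close>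
      by (simp add: irrelevant_ideal_def in_keys_iff)
  qed
  then show ?thesis by (simp add: irrelevant_ideal_def in_keys_iff)
qed

lemma indet_in_irrelevant_ideal: "indet v \<in> irrelevant_ideal"
proof -
  have "Poly_Mapping.single v 1 \<noteq> (0 :: 3 \<Rightarrow>\<^sub>0 nat)"
    by (metis lookup_single_eq lookup_zero zero_neq_one)
  then show ?thesis by (simp add: irrelevant_ideal_def indet_def lookup_single when_def)
qed

section \<open>The Koszul complex on the three indeterminates\<close>

lemma UNIV_3: "(UNIV :: 3 set) = {0, 1, 2}"
  by (rule card_subset_eq[symmetric]) simp_all

text \<open>Division by the three indeterminates in turn leaves a remainder in which no
  indeterminate occurs, that is, the constant term, which is zero here.\<close>

lemma irrelevant_decomposition:
  assumes "p \<in> irrelevant_ideal"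
  defines "p1 \<equiv> mod_indet 0 p" and "p2 \<equiv> mod_indet 1 (mod_indet 0 p)"
  shows "p = indet 0 * div_indet 0 p + indet 1 * div_indet 1 p1 + indet 2 * div_indet 2 p2"
proof -
  have "mod_indet 2 p2 = 0"
  proof (rule poly_mapping_eqI)
    fix \<alpha> :: "3 \<Rightarrow>\<^sub>0 nat"
    have "\<alpha> = 0" if "Poly_Mapping.lookup \<alpha> 0 = 0" "Poly_Mapping.lookup \<alpha> 1 = 0"
      "Poly_Mapping.lookup \<alpha> 2 = 0"
    proof (rule poly_mapping_eqI)
      fix v :: 3
      show "Poly_Mapping.lookup \<alpha> v = Poly_Mapping.lookup 0 v"
        using that UNIV_3 by (metis UNIV_I empty_iff insertE lookup_zero)
    qed
    then show "Poly_Mapping.lookup (mod_indet 2 p2) \<alpha> = Poly_Mapping.lookup 0 \<alpha>"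
      using assms by (auto simp: p2_def when_def irrelevant_ideal_def)
  qed
  then show ?thesis
    using div_mod_indet[of p 0] div_mod_indet[of p1 1] div_mod_indet[of p2 2]
    by (simp add: p1_def p2_def add.assoc)
qed

text \<open>A triple orthogonal to the vector of indeterminates is the cross product of that vector
  with \<open>(g, b1, b2)\<close>. Modulo \<open>indet 0\<close> the relation involves only
  \<open>indet 1\<close> and \<open>indet 2\<close>, whose regularity yields \<open>g\<close>; the
  quotients by \<open>indet 0\<close> supply \<open>b1\<close> and \<open>b2\<close>.\<close>

lemma koszul_exact_2:
  assumes "indet 0 * a0 + indet 1 * a1 + indet 2 * a2 = 0"
  defines "g \<equiv> div_indet 2 (mod_indet 0 a1)" and "b1 \<equiv> div_indet 0 a2" and "b2 \<equiv> - div_indet 0 a1"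
  shows "a0 = indet 1 * b2 - indet 2 * b1" "a1 = indet 2 * g - indet 0 * b2" "a2 = indet 0 * b1 - indet 1 * g"
proof -
  have "mod_indet 0 (indet 0 * a0 + indet 1 * a1 + indet 2 * a2) = 0" using assms by simp
  then have *: "indet 1 * mod_indet 0 a1 + indet 2 * mod_indet 0 a2 = 0"
    by (simp add: mod_indet_add mod_indet_indet_mult)
  then have "indet 1 * mod_indet 0 a1 = indet 2 * (- mod_indet 0 a2)"
    by (simp add: eq_neg_iff_add_eq_0)
  then have m1: "mod_indet 0 a1 = indet 2 * g"
    unfolding g_def by (rule indet_mult_dvd[rotated]) simp
  have "indet 2 * (indet 1 * g + mod_indet 0 a2) = 0"
    using * m1 by (simp add: algebra_simps)
  then have m2: "mod_indet 0 a2 = - (indet 1 * g)"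
    by (simp add: add_eq_0_iff)
  show a1: "a1 = indet 2 * g - indet 0 * b2" using div_mod_indet[of a1 0] m1 by (simp add: b2_def add.commute)
  show a2: "a2 = indet 0 * b1 - indet 1 * g" using div_mod_indet[of a2 0] m2 by (simp add: b1_def algebra_simps)
  \<comment> \<open>With \<open>a1\<close> and \<open>a2\<close> known, the relation determines
    \<open>indet 0 * a0\<close>, and \<open>indet 0\<close> cancels.\<close>
  have "indet 0 * (a0 - (indet 1 * b2 - indet 2 * b1)) = 0"
    using assms(1) by (simp only: a1 a2) (simp add: algebra_simps)
  then have "a0 - (indet 1 * b2 - indet 2 * b1) = 0"
    by (simp only: mult_eq_0_iff) simp
  then show "a0 = indet 1 * b2 - indet 2 * b1" by simp
qed

text \<open>The next spot of the Koszul complex: a triple whose cross product with the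
  indeterminates vanishes is a multiple of them. The first equation shows that
  \<open>indet 0\<close> divides \<open>a0\<close>; cancelling it gives the other two
  entries.\<close>

lemma koszul_exact_1:
  assumes "indet 0 * a1 = indet 1 * a0" "indet 0 * a2 = indet 2 * a0"
  shows "a0 = indet 0 * div_indet 0 a0" "a1 = indet 1 * div_indet 0 a0" "a2 = indet 2 * div_indet 0 a0"
proof -
  show a0: "a0 = indet 0 * div_indet 0 a0"
    by (rule indet_mult_dvd[of 1 _ _ a1]) (use assms in simp_all)
  have "indet 0 * a1 = indet 0 * (indet 1 * div_indet 0 a0)" "indet 0 * a2 = indet 0 * (indet 2 * div_indet 0 a0)"
    using assms a0 by (metis mult.left_commute)+
  then show "a1 = indet 1 * div_indet 0 a0" "a2 = indet 2 * div_indet 0 a0" by simp_all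
qed

section \<open>Linear algebra\<close>

text \<open>The representation of a common element in the basis \<open>C\<close> is unique, so its
  support lies in both \<open>A\<close> and \<open>B\<close>.\<close>

lemma (in vector_space) independent_span_Int:
  assumes "independent C" "A \<subseteq> C" "B \<subseteq> C" "A \<inter> B = {}"
  shows "span A \<inter> span B = {0}"
proof -
  have "x = 0" if "x \<in> span A" "x \<in> span B" for x
  proof -
    have A: "independent A" using assms independent_mono by blast
    have "representation C x = representation A x" "representation C x = representation B x"
      using representation_extend[OF assms(1)] that assms(2,3) by blast+
    then have "representation A x b = 0" for b
      using assms(4) by (metis disjoint_iff representation_ne_zero)
    then show "x = 0"
      using sum_nonzero_representation_eq[OF A that(1)] by simp
  qed
  then show ?thesis by (auto simp: span_zero)
qed

text \<open>The ambient spaces here are infinite-dimensional, so finiteness is required only through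
  a finite set spanning \<open>V\<close>. It is applied with \<open>K\<close> a kernel, for
  rank-nullity, and with \<open>K\<close> a graded piece of the ideal, for the Hilbert
  function.\<close>

lemma (in vector_space) complement_basis:
  assumes "finite S" "V \<subseteq> span S" "subspace V" "subspace K" "K \<subseteq> V"
  obtains D where "finite D" "independent D" "D \<subseteq> V" "K \<inter> span D = {0}"
    "\<And>v. v \<in> V \<Longrightarrow> \<exists>x\<in>K. \<exists>y\<in>span D. v = x + y" "dim V = dim K + card D"
proof -
  obtain B where B: "B \<subseteq> K" "independent B" "K \<subseteq> span B"
    using maximal_independent_subset by blast
  obtain C where C: "B \<subseteq> C" "C \<subseteq> V" "independent C" "V \<subseteq> span C"
    using maximal_independent_subset_extend[of B V] B assms(5) by blast
  have "finite C"
    using independent_span_bound[OF assms(1) C(3)] C(2) assms(2) by blast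
  have K: "K = span B" using B assms(4) by (simp add: span_subspace)
  have "span B \<inter> span (C - B) = {0}"
    using C independent_span_Int[of C B "C - B"] by blast
  moreover have "\<exists>x\<in>K. \<exists>y\<in>span (C - B). v = x + y" if "v \<in> V" for v
  proof -
    have "C = B \<union> (C - B)" using C(1) by blast
    then have "v \<in> span (B \<union> (C - B))" using C(4) that by auto
    then show ?thesis unfolding span_Un K by blast
  qed
  moreover have "dim V = dim K + card (C - B)"
  proof -
    have "dim V = card C" "dim K = card B"
      using basis_card_eq_dim[OF C(2,4,3)] basis_card_eq_dim[OF B(1,3,2)] by simp_all
    then show ?thesis using C(1) \<open>finite C\<close> card_mono[OF \<open>finite C\<close> C(1)]
      by (simp add: card_Diff_subset finite_subset)
  qed
  ultimately show ?thesis
    using that[of "C - B"] \<open>finite C\<close> C independent_mono[OF C(3), of "C - B"] K by blast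
qed

lemma (in vector_space_pair) rank_nullity:
  assumes "finite S" "V \<subseteq> vs1.span S" "vs1.subspace V" "Vector_Spaces.linear s1 s2 f"
  shows "vs1.dim V = vs1.dim {v \<in> V. f v = 0} + vs2.dim (f ` V)"
proof -
  interpret f: Vector_Spaces.linear s1 s2 f by fact
  let ?K = "{v \<in> V. f v = 0}"
  have "vs1.subspace ?K"
    using assms(3) by (auto simp: vs1.subspace_def f.add f.scale f.zero)
  then obtain D where D: "finite D" "vs1.independent D" "D \<subseteq> V" "?K \<inter> vs1.span D = {0}"
    "\<And>v. v \<in> V \<Longrightarrow> \<exists>x\<in>?K. \<exists>y\<in>vs1.span D. v = x + y" "vs1.dim V = vs1.dim ?K + card D"
    using vs1.complement_basis[OF assms(1-3), of ?K] by blast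
  have span: "vs1.span D \<subseteq> V"
    using D(3) assms(3) by (rule vs1.span_minimal)
  have inj: "inj_on f (vs1.span D)"
    using D(4) span by (auto simp: f.inj_on_iff_eq_0[OF vs1.subspace_span])
  have "f ` V = vs2.span (f ` D)"
  proof -
    have "f v \<in> f ` vs1.span D" if "v \<in> V" for v
      using D(5)[OF that] by (auto simp: f.add)
    then show ?thesis using span by (auto simp: f.span_image)
  qed
  moreover have "vs2.independent (f ` D)"
    using D(2) inj by (rule f.independent_injective_image)
  moreover have "card (f ` D) = card D"
    using inj vs1.span_superset by (metis card_image inj_on_subset)
  ultimately have "vs2.dim (f ` V) = card D"
    by (simp add: vs2.dim_eq_card_independent)
  then show ?thesis using D(6) by simp
qed

section \<open>Graded free modules\<close>

text \<open>One vector space over \<open>k\<close> contains all graded pieces of all modules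
  \<open>F_l\<close>, so the differentials are linear maps of a single space into itself.\<close>

definition coeff_scale :: "'k::field_char_0 \<Rightarrow> (nat \<Rightarrow> 'k poly3) \<Rightarrow> nat \<Rightarrow> 'k poly3"
  where "coeff_scale c v = (\<lambda>a. Poly_Mapping.single 0 c * v a)"

interpretation fm: vector_space "coeff_scale :: 'k::field_char_0 \<Rightarrow> _"
  by unfold_locales
    (auto simp: coeff_scale_def fun_eq_iff algebra_simps single_add mult_single single_one)

interpretation fm_pair: vector_space_pair
  "coeff_scale :: 'k::field_char_0 \<Rightarrow> _" "coeff_scale :: 'k::field_char_0 \<Rightarrow> _"
  by unfold_locales

definition graded_part :: "int list \<Rightarrow> int \<Rightarrow> (nat \<Rightarrow> 'k::field_char_0 poly3) set"
  where "graded_part ds n = {v \<in> free_module ds. \<forall>a<length ds. v a \<in> forms (n - ds ! a)}"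

lemma graded_partD:
  "v \<in> graded_part ds n \<Longrightarrow> a < length ds \<Longrightarrow> v a \<in> forms (n - ds ! a)"
  "v \<in> graded_part ds n \<Longrightarrow> a \<ge> length ds \<Longrightarrow> v a = 0"
  "v \<in> graded_part ds n \<Longrightarrow> v \<in> free_module ds"
  by (auto simp: graded_part_def free_module_def)

lemma subspace_graded_part: "fm.subspace (graded_part ds n)"
  by (auto simp: fm.subspace_def graded_part_def free_module_def coeff_scale_def
      intro: forms_add const_mult_in_forms)

definition basis_vec :: "nat \<times> (3 \<Rightarrow>\<^sub>0 nat) \<Rightarrow> nat \<Rightarrow> 'k::field_char_0 poly3"
  where "basis_vec x = (\<lambda>a. if a = fst x then Poly_Mapping.single (snd x) 1 else 0)"

definition basis_index :: "int list \<Rightarrow> int \<Rightarrow> (nat \<times> (3 \<Rightarrow>\<^sub>0 nat)) set"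
  where "basis_index ds n = (SIGMA b:{..<length ds}. {\<alpha>. int (mdeg \<alpha>) = n - ds ! b})"

lemma lookup_basis_vec:
  "Poly_Mapping.lookup (basis_vec x a) \<alpha> = (if x = (a, \<alpha>) then 1 else 0)"
  by (auto simp: basis_vec_def lookup_single when_def prod_eq_iff)

lemma inj_basis_vec: "inj (basis_vec :: _ \<Rightarrow> nat \<Rightarrow> 'k::field_char_0 poly3)"
proof (rule injI)
  fix x y assume "(basis_vec x :: nat \<Rightarrow> 'k poly3) = basis_vec y"
  then have "Poly_Mapping.lookup (basis_vec x (fst y) :: 'k poly3) (snd y) =
      Poly_Mapping.lookup (basis_vec y (fst y)) (snd y)" by simp
  then show "x = y" by (auto simp: lookup_basis_vec split: if_splits)
qed

section \<open>Counting the monomials of a given degree\<close>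

lemma mdeg_3: "mdeg \<alpha> = Poly_Mapping.lookup \<alpha> 0 + Poly_Mapping.lookup \<alpha> 1 + Poly_Mapping.lookup \<alpha> 2"
  unfolding mdeg_def UNIV_3 by simp

lemma bij_betw_monomials:
  "bij_betw (\<lambda>\<alpha>. (Poly_Mapping.lookup \<alpha> (0::3), Poly_Mapping.lookup \<alpha> 1))
    {\<alpha>. mdeg \<alpha> = n} (SIGMA a:{..n}. {..n - a})"
proof (rule bij_betw_byWitness)
  let ?g = "\<lambda>(a, b). Poly_Mapping.single (0::3) a + Poly_Mapping.single 1 b +
    Poly_Mapping.single 2 (n - a - b)"
  show "\<forall>\<alpha>\<in>{\<alpha>. mdeg \<alpha> = n}. ?g (Poly_Mapping.lookup \<alpha> 0, Poly_Mapping.lookup \<alpha> 1) = \<alpha>"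
  proof
    fix \<alpha> assume "\<alpha> \<in> {\<alpha>. mdeg \<alpha> = n}"
    then have n: "n = Poly_Mapping.lookup \<alpha> 0 + Poly_Mapping.lookup \<alpha> 1 + Poly_Mapping.lookup \<alpha> 2"
      by (simp add: mdeg_3)
    show "?g (Poly_Mapping.lookup \<alpha> 0, Poly_Mapping.lookup \<alpha> 1) = \<alpha>"
    proof (rule poly_mapping_eqI)
      fix v :: 3
      have "v = 0 \<or> v = 1 \<or> v = 2" using UNIV_3 by blast
      then show "Poly_Mapping.lookup (?g (Poly_Mapping.lookup \<alpha> 0, Poly_Mapping.lookup \<alpha> 1)) v =
          Poly_Mapping.lookup \<alpha> v"
        by (auto simp: lookup_add lookup_single n)
    qed
  qed
  show "\<forall>x\<in>SIGMA a:{..n}. {..n - a}.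
      (Poly_Mapping.lookup (?g x) 0, Poly_Mapping.lookup (?g x) 1) = x"
    by (auto simp: lookup_add lookup_single)
  show "(\<lambda>\<alpha>. (Poly_Mapping.lookup \<alpha> (0::3), Poly_Mapping.lookup \<alpha> 1)) ` {\<alpha>. mdeg \<alpha> = n}
      \<subseteq> (SIGMA a:{..n}. {..n - a})"
    by (auto simp: mdeg_3)
  show "?g ` (SIGMA a:{..n}. {..n - a}) \<subseteq> {\<alpha>. mdeg \<alpha> = n}"
    by auto
qed

lemma finite_monomials: "finite {\<alpha>. int (mdeg \<alpha>) = n}"
proof -
  have "finite {\<alpha>. mdeg \<alpha> = nat n}"
    using bij_betw_finite[OF bij_betw_monomials] by blast
  then show ?thesis by (rule finite_subset[rotated]) auto
qed

definition monomial_count :: "int \<Rightarrow> nat"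
  where "monomial_count n = card {\<alpha>. int (mdeg \<alpha>) = n}"

lemma monomial_count_neg: "n < 0 \<Longrightarrow> monomial_count n = 0"
  by (simp add: monomial_count_def)

lemma monomial_count_nonneg:
  assumes "n \<ge> 0"
  shows "2 * int (monomial_count n) = (n + 1) * (n + 2)"
proof -
  have gauss: "2 * (\<Sum>a\<le>k. Suc (k - a)) = Suc k * Suc (Suc k)" for k :: nat
    by (induction k) (simp_all add: sum.atMost_Suc_shift del: sum.atMost_Suc)
  have "{\<alpha>. int (mdeg \<alpha>) = n} = {\<alpha>. mdeg \<alpha> = nat n}" using assms by auto
  then have "monomial_count n = (\<Sum>a\<le>nat n. Suc (nat n - a))"
    using bij_betw_same_card[OF bij_betw_monomials[of "nat n"]] by (simp add: monomial_count_def)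
  then have "2 * monomial_count n = Suc (nat n) * Suc (Suc (nat n))"
    using gauss[of "nat n"] by simp
  then have "int (2 * monomial_count n) = int (Suc (nat n) * Suc (Suc (nat n)))" by presburger
  then show ?thesis using assms by (simp add: algebra_simps)
qed

text \<open>The Hilbert series of \<open>R\<close> is \<open>1 / (1 - z)^3\<close>, and taking the
  third difference multiplies it by \<open>(1 - z)^3\<close>.\<close>

lemma third_diff_monomial_count:
  "int (monomial_count n) - 3 * int (monomial_count (n - 1)) + 3 * int (monomial_count (n - 2))
    - int (monomial_count (n - 3)) = (if n = 0 then 1 else 0)"
proof -
  \<comment> \<open>The polynomial \<open>(n + 1) * (n + 2)\<close> vanishes at -1 and -2, so the
    formula is valid from -2 on; for \<open>n > 0\<close> all four arguments then fall in the
    polynomial range.\<close>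
  have "2 * int (monomial_count n) = (if n \<ge> -2 then (n + 1) * (n + 2) else 0)" for n
  proof (cases "n \<ge> 0")
    case False
    then have "n = -1 \<or> n = -2 \<or> n < -2" by auto
    then show ?thesis using False by (auto simp: monomial_count_neg)
  qed (simp add: monomial_count_nonneg)
  note * = this[of n] this[of "n - 1"] this[of "n - 2"] this[of "n - 3"]
  consider "n < -2" | "n = -2" | "n = -1" | "n = 0" | "n > 0" by linarith
  then show ?thesis using * by cases (auto simp: algebra_simps)
qed

lemma sum_fun_apply: "sum f A x = (\<Sum>a\<in>A. f a x)"
  by (induction A rule: infinite_finite_induct) auto

lemma finite_basis_index: "finite (basis_index ds n)"
  by (auto simp: basis_index_def finite_monomials)

lemma basis_vec_in_graded_part: "x \<in> basis_index ds n \<Longrightarrow> basis_vec x \<in> graded_part ds n"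
  by (auto simp: basis_index_def graded_part_def free_module_def basis_vec_def lookup_single
      when_def intro!: formsI split: if_splits)

lemma independent_basis_vec:
  "fm.independent (basis_vec ` basis_index ds n :: (nat \<Rightarrow> 'k::field_char_0 poly3) set)"
proof (rule fm.independent_if_scalars_zero)
  let ?B = "basis_vec ` basis_index ds n :: (nat \<Rightarrow> 'k poly3) set"
  show "finite ?B" by (simp add: finite_basis_index)
  fix f and x :: "nat \<Rightarrow> 'k poly3"
  assume sum: "(\<Sum>x\<in>?B. coeff_scale (f x) x) = 0" and "x \<in> ?B"
  then obtain b \<alpha> where x: "x = basis_vec (b, \<alpha>)" by auto
  have "0 = Poly_Mapping.lookup ((\<Sum>x\<in>?B. coeff_scale (f x) x) b) \<alpha>"
    by (simp add: sum)
  also have "\<dots> = (\<Sum>y\<in>?B. f y * Poly_Mapping.lookup (y b) \<alpha>)"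
    by (simp add: sum_fun_apply lookup_sum coeff_scale_def)
  also have "\<dots> = (\<Sum>y\<in>?B. if y = x then f x else 0)"
  proof (rule sum.cong[OF refl])
    fix y assume "y \<in> ?B"
    then obtain z where "y = basis_vec z" by auto
    then show "f y * Poly_Mapping.lookup (y b) \<alpha> = (if y = x then f x else 0)"
      by (auto simp: lookup_basis_vec x inj_eq[OF inj_basis_vec])
  qed
  also have "\<dots> = f x" using \<open>x \<in> ?B\<close> finite_basis_index by (simp add: sum.delta)
  finally show "f x = 0" by simp
qed

lemma graded_part_map:
  assumes "v \<in> graded_part ds n" "\<And>p d. p \<in> forms d \<Longrightarrow> f p \<in> forms (d + k)" "f 0 = 0"
  shows "(\<lambda>a. f (v a)) \<in> graded_part ds (n + k)"
  using assms(1,3) assms(2)[of _ "n - _"]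
  by (auto simp: graded_part_def free_module_def algebra_simps)

lemma graded_part_span:
  "graded_part ds n \<subseteq> fm.span (basis_vec ` basis_index ds n)"
proof
  fix v :: "nat \<Rightarrow> 'k::field_char_0 poly3"
  assume v: "v \<in> graded_part ds n"
  have "v = (\<Sum>x\<in>basis_index ds n.
      coeff_scale (Poly_Mapping.lookup (v (fst x)) (snd x)) (basis_vec x))" (is "_ = ?s")
  proof (intro ext poly_mapping_eqI)
    fix a \<alpha>
    have "Poly_Mapping.lookup (?s a) \<alpha> = (\<Sum>x\<in>basis_index ds n.
        if x = (a, \<alpha>) then Poly_Mapping.lookup (v a) \<alpha> else 0)"
      by (auto simp: sum_fun_apply lookup_sum coeff_scale_def lookup_basis_vec intro!: sum.cong)
    also have "\<dots> = (if (a, \<alpha>) \<in> basis_index ds n then Poly_Mapping.lookup (v a) \<alpha> else 0)"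
      using finite_basis_index by (simp add: sum.delta)
    also have "\<dots> = Poly_Mapping.lookup (v a) \<alpha>"
    proof (cases "Poly_Mapping.lookup (v a) \<alpha> = 0")
      case False
      then have "a < length ds" using graded_partD(2)[OF v, of a] by force
      moreover have "int (mdeg \<alpha>) = n - ds ! a"
        using formsD[OF graded_partD(1)[OF v] False] calculation by simp
      ultimately show ?thesis by (simp add: basis_index_def)
    qed simp
    finally show "Poly_Mapping.lookup (v a) \<alpha> = Poly_Mapping.lookup (?s a) \<alpha>" by simp
  qed
  then show "v \<in> fm.span (basis_vec ` basis_index ds n)"
    by (metis (no_types, lifting) fm.span_base fm.span_scale fm.span_sum imageI)
qed

lemma dim_graded_part:
  "fm.dim (graded_part ds n :: (nat \<Rightarrow> 'k::field_char_0 poly3) set) =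
    (\<Sum>b<length ds. monomial_count (n - ds ! b))"
proof -
  have "fm.dim (graded_part ds n :: (nat \<Rightarrow> 'k poly3) set) =
      card (basis_vec ` basis_index ds n :: (nat \<Rightarrow> 'k poly3) set)"
    using basis_vec_in_graded_part graded_part_span independent_basis_vec
    by (metis fm.basis_card_eq_dim image_subsetI)
  also have "\<dots> = card (basis_index ds n)"
    by (rule card_image) (meson inj_basis_vec inj_on_subset subset_UNIV)
  finally show ?thesis
    by (simp add: basis_index_def monomial_count_def finite_monomials)
qed

section \<open>Homomorphisms of graded free modules\<close>

lemma mat_apply_add:
  "mat_apply es ds M (\<lambda>a. u a + v a) = (\<lambda>a. mat_apply es ds M u a + mat_apply es ds M v a)"
  by (auto simp: mat_apply_def fun_eq_iff distrib_left sum.distrib)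

lemma mat_apply_mult: "mat_apply es ds M (\<lambda>a. p * u a) = (\<lambda>a. p * mat_apply es ds M u a)"
  by (auto simp: mat_apply_def fun_eq_iff sum_distrib_left mult.left_commute)

lemma mat_apply_diff:
  "mat_apply es ds M (\<lambda>a. u a - v a) = (\<lambda>a. mat_apply es ds M u a - mat_apply es ds M v a)"
  by (auto simp: mat_apply_def fun_eq_iff right_diff_distrib sum_subtractf)

lemma mat_apply_out: "a \<ge> length es \<Longrightarrow> mat_apply es ds M v a = 0"
  by (simp add: mat_apply_def)

lemma mat_apply_in_free_module: "mat_apply es ds M v \<in> free_module es"
  by (simp add: mat_apply_def free_module_def)

lemma linear_mat_apply:
  "Vector_Spaces.linear coeff_scale coeff_scale (mat_apply es ds M)"
  by (intro Vector_Spaces.linear_iff[THEN iffD2])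
    (auto simp: fm.vector_space_axioms mat_apply_add mat_apply_mult coeff_scale_def plus_fun_def)

lemma mat_apply_graded:
  assumes "graded_matrix es ds M" "v \<in> graded_part ds n"
  shows "mat_apply es ds M v \<in> graded_part es n"
proof -
  have "(\<Sum>b<length ds. M a b * v b) \<in> forms (n - es ! a)" if "a < length es" for a
  proof (rule forms_sum)
    fix b assume "b \<in> {..<length ds}"
    then have "M a b * v b \<in> forms ((ds ! b - es ! a) + (n - ds ! b))"
      using assms that by (intro forms_mult) (auto simp: graded_matrix_def dest: graded_partD)
    then show "M a b * v b \<in> forms (n - es ! a)" by simp
  qed
  then show ?thesis by (auto simp: graded_part_def free_module_def mat_apply_def)
qed

text \<open>A preimage of a homogeneous element need not be homogeneous. Keeping in each entry only
  the component of the degree prescribed by its shift does not change the image.\<close>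

lemma mat_apply_graded_lift:
  assumes "graded_matrix es ds M" "mat_apply es ds M u \<in> graded_part es n"
  obtains u' where "u' \<in> graded_part ds n" "mat_apply es ds M u' = mat_apply es ds M u"
proof
  define u' where "u' = (\<lambda>b. if b < length ds then hom_component (n - ds ! b) (u b) else 0)"
  show "u' \<in> graded_part ds n"
    by (auto simp: graded_part_def free_module_def u'_def hom_component_in_forms)
  show "mat_apply es ds M u' = mat_apply es ds M u"
  proof
    fix a
    show "mat_apply es ds M u' a = mat_apply es ds M u a"
    proof (cases "a < length es")
      case True
      have "M a b * hom_component (n - ds ! b) (u b) = hom_component (n - es ! a) (M a b * u b)"
        if "b < length ds" for b
        using hom_component_mult[of "M a b" "ds ! b - es ! a" "n - es ! a" "u b"] assms(1) True that
        by (simp add: graded_matrix_def)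
      then have "mat_apply es ds M u' a = (\<Sum>b<length ds. hom_component (n - es ! a) (M a b * u b))"
        using True by (simp add: mat_apply_def u'_def)
      also have "\<dots> = hom_component (n - es ! a) (mat_apply es ds M u a)"
        using True by (simp add: mat_apply_def hom_component_sum)
      also have "\<dots> = mat_apply es ds M u a"
        using graded_partD(1)[OF assms(2) True] by (rule hom_component_forms)
      finally show ?thesis .
    qed (simp add: mat_apply_def)
  qed
qed

lemma mat_apply_irrelevant:
  assumes "\<forall>a<length es. \<forall>b<length ds. M a b \<in> irrelevant_ideal"
  shows "mat_apply es ds M v a \<in> irrelevant_ideal"
  using assms by (auto simp: mat_apply_def intro!: irrelevant_ideal_sum irrelevant_ideal_mult)

section \<open>The Hilbert function of a quotient\<close>

lemma R3_simps [simp]: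
  "carrier R3 = UNIV" "p \<otimes>\<^bsub>R3\<^esub> q = p * q" "p \<oplus>\<^bsub>R3\<^esub> q = p + q" "\<one>\<^bsub>R3\<^esub> = 1" "\<zero>\<^bsub>R3\<^esub> = 0"
  for p q :: "'k::field_char_0 poly3"
  by (simp_all add: ring_of_type_algebra_def)

lemma cring_R3: "cring (R3 :: 'k::field_char_0 poly3 ring)"
  by (rule cring_from_type_algebra)

lemma R3_a_inv [simp]: "\<ominus>\<^bsub>R3\<^esub> p = - p" for p :: "'k::field_char_0 poly3"
proof -
  interpret cring "R3 :: 'k poly3 ring" by (rule cring_R3)
  show ?thesis using minus_equality[of "- p" p] by simp
qed

lemma subfield_constants: "subfield constants (R3 :: 'k::field_char_0 poly3 ring)"
proof -
  interpret cring "R3 :: 'k poly3 ring" by (rule cring_R3)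
  have sub: "subring constants (R3 :: 'k poly3 ring)"
  proof (rule subringI)
    show "\<one>\<^bsub>R3\<^esub> \<in> (constants :: 'k poly3 set)" by (auto simp: constants_def intro!: exI[of _ 1])
  qed (auto simp: constants_def mult_single single_add[symmetric] single_uminus[symmetric])
  have "Poly_Mapping.single 0 a \<in> Units (R3\<lparr>carrier := constants\<rparr>)" if "a \<noteq> 0" for a :: 'k
    using that unfolding Units_def
    by (auto simp: constants_def) (rule exI[of _ "Poly_Mapping.single 0 (inverse a)"], auto simp: mult_single)
  moreover have "0 \<notin> Units (R3\<lparr>carrier := constants :: 'k poly3 set\<rparr>)"
    by (auto simp: Units_def)
  ultimately have "Units (R3\<lparr>carrier := constants\<rparr>) = constants - {\<zero>\<^bsub>R3 :: 'k poly3 ring\<^esub>}"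
  proof (intro equalityI subsetI)
    fix x assume "x \<in> constants - {\<zero>\<^bsub>R3 :: 'k poly3 ring\<^esub>}"
    then obtain a where "x = Poly_Mapping.single 0 a" "x \<noteq> 0" by (auto simp: constants_def)
    moreover from this have "a \<noteq> 0" by auto
    ultimately show "x \<in> Units (R3\<lparr>carrier := constants\<rparr>)"
      using \<open>\<And>a. a \<noteq> 0 \<Longrightarrow> Poly_Mapping.single 0 a \<in> Units (R3\<lparr>carrier := constants\<rparr>)\<close> by blast
  qed (auto simp: Units_def)
  then show ?thesis using subfieldI[OF subcringI'[OF sub]] by blast
qed

locale homogeneous =
  fixes I :: "'k::field_char_0 poly3 set"
  assumes homogeneous: "homogeneous_ideal I"
begin

lemma ideal_I: "ideal I R3"
  using homogeneous by (simp add: homogeneous_ideal_def)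

sublocale residue_hom: ring_hom_ring R3 "quot_alg I" "residue I"
  by (rule ideal.rcos_ring_hom_ring[OF ideal_I])

lemma zero_in_I [simp]: "0 \<in> I"
  using additive_subgroup.zero_closed[OF ideal.axioms(1)[OF ideal_I]] by simp

lemma I_add: "p \<in> I \<Longrightarrow> q \<in> I \<Longrightarrow> p + q \<in> I"
  using additive_subgroup.a_closed[OF ideal.axioms(1)[OF ideal_I]] by simp

lemma I_mult: "q \<in> I \<Longrightarrow> p * q \<in> I"
  using ideal.I_l_closed[OF ideal_I] by simp

lemma residue_eq_iff: "residue I p = residue I q \<longleftrightarrow> p - q \<in> I"
  using residue_hom.R.quotient_eq_iff_same_a_r_cos[OF ideal_I, of p q]
  by (simp add: a_minus_def)

lemma residue_simps:
  "residue I (p + q) = residue I p \<oplus>\<^bsub>quot_alg I\<^esub> residue I q"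
  "residue I (p * q) = residue I p \<otimes>\<^bsub>quot_alg I\<^esub> residue I q"
  "residue I 0 = \<zero>\<^bsub>quot_alg I\<^esub>"
  "residue I 1 = \<one>\<^bsub>quot_alg I\<^esub>"
  "residue I p \<in> carrier (quot_alg I)"
  using residue_hom.hom_add[of p q] residue_hom.hom_mult[of p q] residue_hom.hom_zero
    residue_hom.hom_one residue_hom.hom_closed[of p] by simp_all

lemma residue_eq_zero_iff: "residue I p = \<zero>\<^bsub>quot_alg I\<^esub> \<longleftrightarrow> p \<in> I"
  using residue_eq_iff[of p 0] by (simp add: residue_simps)

lemma quot_part_eq_zero_iff: "quot_part I n = {\<zero>\<^bsub>quot_alg I\<^esub>} \<longleftrightarrow> forms n \<subseteq> I"
proof -
  have singleton: "A = {z} \<longleftrightarrow> (\<forall>r\<in>A. r = z)" if "A \<noteq> {}" for A and z :: "'k poly3 set"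
    using that by auto
  have "quot_part I n \<noteq> {}"
    unfolding quot_part_def by (metis empty_iff image_is_empty zero_in_forms)
  then have "quot_part I n = {\<zero>\<^bsub>quot_alg I\<^esub>} \<longleftrightarrow> (\<forall>r\<in>quot_part I n. r = \<zero>\<^bsub>quot_alg I\<^esub>)"
    by (rule singleton)
  also have "\<dots> \<longleftrightarrow> (\<forall>p\<in>forms n. p \<in> I)"
    unfolding quot_part_def Set.ball_simps residue_eq_zero_iff by (rule refl)
  finally show ?thesis by blast
qed

text \<open>Translates between the two notions of dimension. The third hypothesis makes the residue
  map injective on the span, so each further basis vector adds exactly one line extension, the
  inductive step in the definition of \<open>dimension\<close>.\<close>

lemma dimension_residue_span:
  assumes "finite B" "fm.independent B" "\<forall>v\<in>fm.span B. v 0 \<in> I \<longrightarrow> v = 0"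
  shows "ring.dimension (quot_alg I) (card B) (residue I ` constants)
    ((\<lambda>v. residue I (v 0)) ` fm.span B)"
  using assms
proof (induction B rule: finite_induct)
  case empty
  then show ?case using residue_hom.S.dimension.zero_dim by (simp add: residue_simps)
next
  case (insert b B)
  let ?K = "residue I ` constants" and ?res = "\<lambda>v :: nat \<Rightarrow> 'k poly3. residue I (v 0)"
  have sub: "fm.span B \<subseteq> fm.span (insert b B)" by (rule fm.span_mono) blast
  have b: "b \<notin> fm.span B" "fm.independent B"
    using insert.prems(1) insert.hyps(2) by (simp_all add: fm.independent_insert)
  have "residue I (b 0) \<notin> ?res ` fm.span B"
  proof
    assume "residue I (b 0) \<in> ?res ` fm.span B"
    then obtain y where y: "y \<in> fm.span B" "(b - y) 0 \<in> I" by (auto simp: residue_eq_iff)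
    then have "b - y \<in> fm.span (insert b B)"
      using sub by (meson fm.span_base fm.span_diff insertI1 subsetD)
    then have "b - y = 0" using insert.prems(2) y(2) by blast
    then show False using b(1) y(1) by simp
  qed
  moreover have "residue_hom.S.dimension (card B) ?K (?res ` fm.span B)"
    using insert.IH b(2) insert.prems(2) sub by blast
  ultimately have "residue_hom.S.dimension (Suc (card B)) ?K
      (residue_hom.S.line_extension ?K (residue I (b 0)) (?res ` fm.span B))"
    by (intro residue_hom.S.dimension.Suc_dim) (simp_all add: residue_simps)
  moreover have "residue_hom.S.line_extension ?K (residue I (b 0)) (?res ` fm.span B) =
      ?res ` fm.span (insert b B)"
  proof -
    have eq: "residue I (Poly_Mapping.single 0 k) \<otimes>\<^bsub>quot_alg I\<^esub> residue I (b 0) \<oplus>\<^bsub>quot_alg I\<^esub> ?res y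
        = ?res (coeff_scale k b + y)" for k y
      by (simp add: residue_simps coeff_scale_def)
    have "?res ` fm.span (insert b B) = {?res (coeff_scale k b + y) | k y. y \<in> fm.span B}"
    proof (intro equalityI subsetI)
      fix r assume "r \<in> ?res ` fm.span (insert b B)"
      then obtain x k where "r = ?res x" "x - coeff_scale k b \<in> fm.span B"
        by (auto simp: fm.span_insert)
      then show "r \<in> {?res (coeff_scale k b + y) | k y. y \<in> fm.span B}"
        by (auto intro!: exI[of _ k] exI[of _ "x - coeff_scale k b"])
    next
      fix r assume "r \<in> {?res (coeff_scale k b + y) | k y. y \<in> fm.span B}"
      then obtain k y where "r = ?res (coeff_scale k b + y)" "y \<in> fm.span B" by blast
      moreover from this have "coeff_scale k b + y \<in> fm.span (insert b B)"
        using sub by (meson fm.span_add fm.span_base fm.span_scale insertI1 subsetD)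
      ultimately show "r \<in> ?res ` fm.span (insert b B)" by blast
    qed
    also have "\<dots> = residue_hom.S.line_extension ?K (residue I (b 0)) (?res ` fm.span B)"
      unfolding residue_hom.S.line_extension_def set_add_def' r_coset_def eq[symmetric] constants_def
      by (auto simp: image_iff)
    finally show ?thesis by simp
  qed
  ultimately show ?case using insert.hyps by simp
qed

text \<open>The degree \<open>n\<close> piece of the ideal, written as families over the shift list
  \<open>[0]\<close>, so that \<open>F_0 = R\<close> is handled by the same linear algebra as the
  other modules.\<close>

definition I_part :: "int \<Rightarrow> (nat \<Rightarrow> 'k poly3) set"
  where "I_part n = {v \<in> graded_part [0] n. v 0 \<in> I}"

lemma subspace_I_part: "fm.subspace (I_part n)"
  using subspace_graded_part[of "[0]" n]
  by (auto simp: I_part_def fm.subspace_def I_add coeff_scale_def I_mult)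

lemma forms_image: "(\<lambda>v. v 0) ` graded_part [0] n = forms n"
proof -
  have "p \<in> (\<lambda>v. v 0) ` graded_part [0] n" if "p \<in> forms n" for p :: "'a poly3"
    using that by (intro image_eqI[of _ _ "\<lambda>a. if a = 0 then p else 0"])
      (auto simp: graded_part_def free_module_def)
  then show ?thesis by (auto dest: graded_partD(1)[of _ "[0]" n 0])
qed

text \<open>A complement of \<open>I_n\<close> in \<open>R_n\<close> is mapped isomorphically onto
  the degree \<open>n\<close> part of the quotient, so its dimension is the value of the Hilbert
  function.\<close>

lemma hilb_complement:
  assumes "1 \<notin> I"
  obtains B where "finite B" "fm.independent B"
    "fm.dim (graded_part [0] n :: (nat \<Rightarrow> 'k poly3) set) = fm.dim (I_part n) + card B"
    "hilb I n = card B" "quot_part I n = (\<lambda>v. residue I (v 0)) ` fm.span B"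
proof -
  obtain B where B: "finite B" "fm.independent B" "B \<subseteq> graded_part [0] n"
    "I_part n \<inter> fm.span B = {0}"
    "\<And>v. v \<in> graded_part [0] n \<Longrightarrow> \<exists>x\<in>I_part n. \<exists>y\<in>fm.span B. v = x + y"
    "fm.dim (graded_part [0] n :: (nat \<Rightarrow> 'k poly3) set) = fm.dim (I_part n) + card B"
    using fm.complement_basis[OF _ graded_part_span subspace_graded_part subspace_I_part, of "[0]" n n]
      finite_basis_index by (auto simp: I_part_def)
  have span: "fm.span B \<subseteq> graded_part [0] n"
    using B(3) subspace_graded_part by (rule fm.span_minimal)
  have part: "quot_part I n = (\<lambda>v. residue I (v 0)) ` fm.span B"
  proof -
    have "residue I (v 0) \<in> (\<lambda>v. residue I (v 0)) ` fm.span B" 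
      if v: "v \<in> graded_part [0] n" for v
    proof -
      obtain x y where "x \<in> I_part n" "y \<in> fm.span B" "v = x + y" using B(5)[OF v] by blast
      then show ?thesis by (intro image_eqI[of _ _ y]) (auto simp: residue_eq_iff I_part_def)
    qed
    then show ?thesis using span by (auto simp: quot_part_def forms_image[symmetric])
  qed
  \<comment> \<open>The dimension is well defined only over a field; \<open>1 \<notin> I\<close>
    ensures that the residues of the constants still form one.\<close>
  have "subfield (residue I ` constants) (quot_alg I)"
  proof (rule residue_hom.img_is_subfield(2)[OF subfield_constants])
    show "\<one>\<^bsub>quot_alg I\<^esub> \<noteq> \<zero>\<^bsub>quot_alg I\<^esub>"
      using assms residue_eq_zero_iff[of 1] by (simp add: residue_simps)
  qed
  moreover have "residue_hom.S.dimension (card B) (residue I ` constants) (quot_part I n)"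
    unfolding part
    by (rule dimension_residue_span) (use B span in \<open>auto simp: I_part_def\<close>)
  ultimately have "hilb I n = card B"
    using residue_hom.S.dimI by (simp add: hilb_def over_def)
  then show ?thesis using that B part by blast
qed

lemma dim_eq_hilb:
  "1 \<notin> I \<Longrightarrow>
    fm.dim (graded_part [0] n :: (nat \<Rightarrow> 'k poly3) set) = fm.dim (I_part n) + hilb I n"
  by (erule hilb_complement[of n]) simp

lemma hilb_eq_0_iff:
  assumes "1 \<notin> I"
  shows "hilb I n = 0 \<longleftrightarrow> forms n \<subseteq> I"
proof -
  obtain B where B: "finite B" "fm.independent B" "hilb I n = card B"
    "quot_part I n = (\<lambda>v. residue I (v 0)) ` fm.span B"
    "fm.dim (graded_part [0] n :: (nat \<Rightarrow> 'k poly3) set) = fm.dim (I_part n) + card B"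
    using hilb_complement[OF assms, of n] by metis
  show ?thesis
  proof
    assume "hilb I n = 0"
    then have "B = {}" using B by simp
    then show "forms n \<subseteq> I"
      using B(4) by (simp add: quot_part_eq_zero_iff[symmetric] residue_simps)
  next
    assume "forms n \<subseteq> I"
    then have "I_part n = graded_part [0] n"
      using forms_image[of n] by (auto simp: I_part_def)
    then show "hilb I n = 0" using B by simp
  qed
qed

end

section \<open>Betti numbers\<close>

locale resolution = homogeneous I for I :: "'k::field_char_0 poly3 set" +
  fixes D :: "nat \<Rightarrow> int list" and \<Phi> :: "nat \<Rightarrow> nat \<Rightarrow> nat \<Rightarrow> 'k poly3"
  assumes minimal_resolution: "minimal_resolution I D \<Phi>"
    and proper: "1 \<notin> I"
begin

abbreviation \<phi> :: "nat \<Rightarrow> (nat \<Rightarrow> 'k poly3) \<Rightarrow> nat \<Rightarrow> 'k poly3"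
  where "\<phi> l \<equiv> mat_apply (D (l - 1)) (D l) (\<Phi> l)"

definition betti :: "nat \<Rightarrow> int \<Rightarrow> nat"
  where "betti l n = card {b. b < length (D l) \<and> D l ! b = n}"

lemma betti_pos_iff: "0 < betti l n \<longleftrightarrow> n \<in> set (D l)"
  by (auto simp: betti_def card_gt_0_iff in_set_conv_nth)

lemma D_0 [simp]: "D 0 = [0]" and D_4 [simp]: "D 4 = []"
  using minimal_resolution by (simp_all add: minimal_resolution_def)

lemma graded_\<phi>:
  assumes "l \<in> {1..4}"
  shows "graded_matrix (D (l - 1)) (D l) (\<Phi> l)"
proof (cases "l = 4")
  case True
  then show ?thesis by (simp add: graded_matrix_def)
next
  case False
  then show ?thesis using assms minimal_resolution by (simp add: minimal_resolution_def)
qed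

lemma image_\<phi>_1: "p \<in> I \<longleftrightarrow> (\<exists>u\<in>free_module (D 1). \<phi> 1 u 0 = p)"
proof -
  have *: "\<phi> 1 ` free_module (D 1) = {v \<in> free_module [0]. v 0 \<in> I}"
    using minimal_resolution by (simp add: minimal_resolution_def)
  show ?thesis
  proof
    assume "p \<in> I"
    then have "(\<lambda>a. if a = 0 then p else 0) \<in> \<phi> 1 ` free_module (D 1)"
      unfolding * by (simp add: free_module_def)
    then obtain u where "u \<in> free_module (D 1)" "\<phi> 1 u = (\<lambda>a. if a = 0 then p else 0)"
      by (metis (no_types, lifting) imageE)
    then show "\<exists>u\<in>free_module (D 1). \<phi> 1 u 0 = p" by (intro bexI[of _ u]) simp_all
  qed (use * in blast)
qed

lemma exact:
  assumes "l \<in> {1..3}" "v \<in> free_module (D l)"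
  shows "\<phi> l v = (\<lambda>_. 0) \<longleftrightarrow> (\<exists>u\<in>free_module (D (l + 1)). v = \<phi> (l + 1) u)"
proof -
  have "{v \<in> free_module (D l). \<phi> l v = (\<lambda>_. 0)} = \<phi> (l + 1) ` free_module (D (l + 1))"
    using minimal_resolution assms(1) by (simp add: minimal_resolution_def)
  then show ?thesis using assms(2) by blast
qed

lemma inj_\<phi>_3:
  assumes "v \<in> free_module (D 3)" "\<phi> 3 v = (\<lambda>_. 0)"
  shows "v = (\<lambda>_. 0)"
proof -
  obtain u where "v = \<phi> 4 u" using exact[of 3 v] assms by auto
  then show ?thesis by (auto simp: mat_apply_def fun_eq_iff)
qed

lemma image_irrelevant:
  assumes "l \<in> {1..4}"
  shows "\<phi> l u a \<in> irrelevant_ideal"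
proof -
  have "\<forall>a<length (D (l - 1)). \<forall>b<length (D l). \<Phi> l a b \<in> irrelevant_ideal"
  proof (cases "l = 4")
    case False
    then show ?thesis using minimal_resolution assms by (simp add: minimal_resolution_def)
  qed simp
  then show ?thesis by (rule mat_apply_irrelevant)
qed

lemma kernel_irrelevant:
  assumes "l \<in> {1..3}" "v \<in> free_module (D l)" "\<phi> l v = (\<lambda>_. 0)"
  shows "v a \<in> irrelevant_ideal"
  using exact[OF assms(1,2)] assms(1,3) image_irrelevant[of "l + 1"] by auto

text \<open>Exactness in a single degree: an arbitrary preimage is replaced by its homogeneous
  part.\<close>

lemma kernel_graded:
  assumes l: "l \<in> {1..3}"
  shows "{v \<in> graded_part (D l) n. \<phi> l v = 0} = \<phi> (l + 1) ` graded_part (D (l + 1)) n"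
proof (intro equalityI subsetI)
  fix v assume "v \<in> {v \<in> graded_part (D l) n. \<phi> l v = 0}"
  then have v: "v \<in> graded_part (D l) n" "\<phi> l v = (\<lambda>_. 0)" by (auto simp: fun_eq_iff)
  then obtain u where u: "v = \<phi> (l + 1) u" using exact[OF l graded_partD(3)[OF v(1)]] by blast
  have "\<phi> (l + 1) u \<in> graded_part (D (l + 1 - 1)) n" using v(1) u by simp
  moreover have "graded_matrix (D (l + 1 - 1)) (D (l + 1)) (\<Phi> (l + 1))"
    using graded_\<phi>[of "l + 1"] l by simp
  ultimately obtain u' where "u' \<in> graded_part (D (l + 1)) n" "\<phi> (l + 1) u' = \<phi> (l + 1) u"
    using mat_apply_graded_lift by blast
  then show "v \<in> \<phi> (l + 1) ` graded_part (D (l + 1)) n" using u by (metis imageI)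
next
  fix v assume "v \<in> \<phi> (l + 1) ` graded_part (D (l + 1)) n"
  then obtain u where u: "u \<in> graded_part (D (l + 1)) n" "v = \<phi> (l + 1) u" by blast
  then have v: "v \<in> graded_part (D l) n"
    using mat_apply_graded[OF graded_\<phi>[of "l + 1"] u(1)] l by simp
  moreover have "\<phi> l v = (\<lambda>_. 0)"
    using exact[OF l graded_partD(3)[OF v]] u graded_partD(3)[OF u(1)] by blast
  ultimately show "v \<in> {v \<in> graded_part (D l) n. \<phi> l v = 0}" by (simp add: zero_fun_def)
qed

lemma image_graded: "\<phi> 1 ` graded_part (D 1) n = I_part n"
proof (intro equalityI subsetI)
  fix v assume "v \<in> \<phi> 1 ` graded_part (D 1) n"
  then obtain u where u: "u \<in> graded_part (D 1) n" "v = \<phi> 1 u" by blast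
  then have "v \<in> graded_part [0] n"
    using mat_apply_graded[OF graded_\<phi>[of 1] u(1)] by simp
  moreover have "v 0 \<in> I" using image_\<phi>_1 u graded_partD(3) by blast
  ultimately show "v \<in> I_part n" by (simp add: I_part_def)
next
  fix v assume v: "v \<in> I_part n"
  then obtain u where u: "\<phi> 1 u 0 = v 0" using image_\<phi>_1 by (auto simp: I_part_def)
  have "\<phi> 1 u = v"
  proof
    fix a show "\<phi> 1 u a = v a"
      using u v by (cases "a = 0") (auto simp: mat_apply_def I_part_def graded_part_def free_module_def)
  qed
  then have "\<phi> 1 u \<in> graded_part (D (1 - 1)) n" using v by (simp add: I_part_def)
  moreover have "graded_matrix (D (1 - 1)) (D 1) (\<Phi> 1)"
    using graded_\<phi>[of 1] by simp
  ultimately obtain u' where "u' \<in> graded_part (D 1) n" "\<phi> 1 u' = \<phi> 1 u"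
    using mat_apply_graded_lift by blast
  then show "v \<in> \<phi> 1 ` graded_part (D 1) n" using \<open>\<phi> 1 u = v\<close> by (metis imageI)
qed

lemma dim_image:
  assumes "l \<in> {1..3}"
  shows "fm.dim (graded_part (D l) n :: (nat \<Rightarrow> 'k poly3) set) =
    fm.dim (\<phi> (l + 1) ` graded_part (D (l + 1)) n) + fm.dim (\<phi> l ` graded_part (D l) n)"
  using fm_pair.rank_nullity[OF _ graded_part_span subspace_graded_part linear_mat_apply,
      of "D l" n "D (l - 1)" "D l" "\<Phi> l"] finite_basis_index
  by (simp only: kernel_graded[OF assms] finite_imageI)

lemma hilb_resolution:
  "int (hilb I n) = int (monomial_count n)
    - (\<Sum>b<length (D 1). int (monomial_count (n - D 1 ! b)))
    + (\<Sum>b<length (D 2). int (monomial_count (n - D 2 ! b)))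
    - (\<Sum>b<length (D 3). int (monomial_count (n - D 3 ! b)))"
proof -
  \<comment> \<open>The dimensions of the images telescope, starting from
    \<open>F_4 = 0\<close>.\<close>
  have "\<phi> 4 ` graded_part (D 4) n = {0}"
    using subspace_graded_part[of "D 4" n]
    by (auto simp: mat_apply_def fun_eq_iff fm.subspace_def image_iff)
  then have "fm.dim (\<phi> 4 ` graded_part (D 4) n) = 0"
    using fm.dim_span_eq_card_independent[OF fm.independent_empty] by simp
  then have 3: "fm.dim (graded_part (D 3) n :: (nat \<Rightarrow> 'k poly3) set) =
      fm.dim (\<phi> 3 ` graded_part (D 3) n)"
    using dim_image[of 3 n] by simp
  have 2: "fm.dim (graded_part (D 2) n :: (nat \<Rightarrow> 'k poly3) set) =
      fm.dim (\<phi> 3 ` graded_part (D 3) n) + fm.dim (\<phi> 2 ` graded_part (D 2) n)"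
    using dim_image[of 2 n] by simp
  have 1: "fm.dim (graded_part (D 1) n :: (nat \<Rightarrow> 'k poly3) set) =
      fm.dim (\<phi> 2 ` graded_part (D 2) n) + fm.dim (I_part n)"
    using dim_image[of 1 n] unfolding image_graded one_add_one by simp
  have "int (fm.dim (I_part n)) =
      int (fm.dim (graded_part (D 1) n :: (nat \<Rightarrow> 'k poly3) set))
      - int (fm.dim (graded_part (D 2) n :: (nat \<Rightarrow> 'k poly3) set))
      + int (fm.dim (graded_part (D 3) n :: (nat \<Rightarrow> 'k poly3) set))"
    using 1 2 3 by linarith
  then show ?thesis using dim_eq_hilb[OF proper, of n] by (simp add: dim_graded_part)
qed

lemma third_diff_betti:
  "third_diff I n = (if n = 0 then 1 else 0) - int (betti 1 n) + int (betti 2 n) - int (betti 3 n)"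
proof -
  \<comment> \<open>\<open>S l\<close> is the Hilbert function of \<open>F_l\<close>; its third
    difference picks out the shifts equal to \<open>n\<close>.\<close>
  define S where "S l n = (\<Sum>b<length (D l). int (monomial_count (n - D l ! b)))" for l n
  have S: "S l n - 3 * S l (n - 1) + 3 * S l (n - 2) - S l (n - 3) = int (betti l n)" for l
  proof -
    have "S l n - 3 * S l (n - 1) + 3 * S l (n - 2) - S l (n - 3) =
        (\<Sum>b<length (D l). int (monomial_count (n - D l ! b)) - 3 * int (monomial_count (n - D l ! b - 1))
          + 3 * int (monomial_count (n - D l ! b - 2)) - int (monomial_count (n - D l ! b - 3)))"
      unfolding S_def sum_distrib_left sum.distrib[symmetric] sum_subtractf[symmetric]
      by (rule sum.cong) (simp_all add: algebra_simps)
    also have "\<dots> = (\<Sum>b<length (D l). if D l ! b = n then 1 else 0)"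
      by (intro sum.cong) (auto simp: third_diff_monomial_count)
    also have "\<dots> = int (betti l n)"
      by (simp add: betti_def sum.If_cases lessThan_def Int_def conj_commute)
    finally show ?thesis .
  qed
  show ?thesis
    using hilb_resolution[of n] hilb_resolution[of "n - 1"] hilb_resolution[of "n - 2"]
      hilb_resolution[of "n - 3"] third_diff_monomial_count[of n] S[of 1] S[of 2] S[of 3]
    unfolding third_diff_def S_def by linarith
qed

section \<open>Minimality and the growth of the shifts\<close>

definition unit_vec :: "nat \<Rightarrow> nat \<Rightarrow> 'k poly3"
  where "unit_vec b = (\<lambda>a. if a = b then 1 else 0)"

lemma unit_vec_graded: "b < length (D l) \<Longrightarrow> unit_vec b \<in> graded_part (D l) (D l ! b)"
  using const_in_forms[of 1]
  by (auto simp: unit_vec_def graded_part_def free_module_def)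

lemma unit_vec_not_irrelevant: "unit_vec b b \<notin> irrelevant_ideal"
  by (simp add: unit_vec_def irrelevant_ideal_def)

text \<open>By minimality kernels lie in the irrelevant ideal times \<open>F_l\<close>, so a basis
  vector has nonzero image. A nonzero entry of that image is a form in the irrelevant ideal, hence
  of positive degree.\<close>

lemma shift_increasing:
  assumes l: "l \<in> {1..3}" and "d \<in> set (D l)"
  shows "\<exists>d'\<in>set (D (l - 1)). d' < d"
proof -
  obtain b where b: "b < length (D l)" "D l ! b = d" using assms(2) by (auto simp: in_set_conv_nth)
  have u: "unit_vec b \<in> graded_part (D l) d" using unit_vec_graded b by blast
  have "\<phi> l (unit_vec b) \<noteq> (\<lambda>_. 0)"
    using kernel_irrelevant[OF l graded_partD(3)[OF u]] unit_vec_not_irrelevant by blast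
  then obtain a where a: "\<phi> l (unit_vec b) a \<noteq> 0" by auto
  have g: "\<phi> l (unit_vec b) \<in> graded_part (D (l - 1)) d"
    using mat_apply_graded[OF graded_\<phi> u] l by simp
  have "a < length (D (l - 1))" using a graded_partD(2)[OF g] by (meson not_le)
  moreover have "D (l - 1) ! a < d"
  proof (rule ccontr)
    assume "\<not> D (l - 1) ! a < d"
    then have "\<phi> l (unit_vec b) a = 0"
      using graded_partD(1)[OF g \<open>a < length (D (l - 1))\<close>] image_irrelevant[of l "unit_vec b" a] l
      by (cases "d = D (l - 1) ! a") (auto dest: forms_0_irrelevant forms_neg)
    then show False using a by blast
  qed
  ultimately show ?thesis by auto
qed

text \<open>The shifts grow from the single shift 0 of \<open>F_0\<close>. Positivity is what allows
  the inequalities between shifts to be multiplied.\<close>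

lemma shift_pos: "l \<in> {1..3} \<Longrightarrow> d \<in> set (D l) \<Longrightarrow> 0 < d"
proof (induction l arbitrary: d)
  case (Suc l)
  obtain d' where d': "d' \<in> set (D l)" "d' < d" using shift_increasing[OF Suc.prems] by auto
  show ?case
  proof (cases "l = 0")
    case False
    then show ?thesis using Suc.IH[OF _ d'(1)] Suc.prems(1) d'(2) by auto
  qed (use d' in auto)
qed simp

end

section \<open>The socle and the last module\<close>

text \<open>The explicit witnesses of \<open>koszul_exact_2\<close>, taken entry by entry, have
  degree one less.\<close>

lemma koszul_exact_2_graded:
  assumes "u0 \<in> graded_part ds n" "u1 \<in> graded_part ds n" "u2 \<in> graded_part ds n"
    and "\<And>a. indet 0 * u0 a + indet 1 * u1 a + indet 2 * u2 a = 0"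
  obtains w0 w1 w2 where "w0 \<in> graded_part ds (n - 1)" "w1 \<in> graded_part ds (n - 1)"
    "w2 \<in> graded_part ds (n - 1)"
    "\<And>a. u0 a = indet 1 * w2 a - indet 2 * w1 a"
    "\<And>a. u1 a = indet 2 * w0 a - indet 0 * w2 a"
    "\<And>a. u2 a = indet 0 * w1 a - indet 1 * w0 a"
proof
  show "(\<lambda>a. div_indet 2 (mod_indet 0 (u1 a))) \<in> graded_part ds (n - 1)"
    using graded_part_map[OF assms(2), of "\<lambda>p. div_indet 2 (mod_indet 0 p)" "-1"]
    by (simp add: div_indet_in_forms mod_indet_in_forms)
  show "(\<lambda>a. div_indet 0 (u2 a)) \<in> graded_part ds (n - 1)"
    using graded_part_map[OF assms(3), of "div_indet 0" "-1"] by (simp add: div_indet_in_forms)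
  show "(\<lambda>a. - div_indet 0 (u1 a)) \<in> graded_part ds (n - 1)"
    using graded_part_map[OF assms(2), of "\<lambda>p. - div_indet 0 p" "-1"]
    by (simp add: div_indet_in_forms forms_minus)
qed (rule koszul_exact_2[OF assms(4)])+

lemma irrelevant_decomposition_graded:
  assumes "y \<in> graded_part ds n" "\<And>a. y a \<in> irrelevant_ideal"
  obtains u0 u1 u2 where "u0 \<in> graded_part ds (n - 1)" "u1 \<in> graded_part ds (n - 1)"
    "u2 \<in> graded_part ds (n - 1)"
    "\<And>a. y a = indet 0 * u0 a + indet 1 * u1 a + indet 2 * u2 a"
proof
  show "(\<lambda>a. div_indet 0 (y a)) \<in> graded_part ds (n - 1)"
    using graded_part_map[OF assms(1), of "div_indet 0" "-1"] by (simp add: div_indet_in_forms)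
  show "(\<lambda>a. div_indet 1 (mod_indet 0 (y a))) \<in> graded_part ds (n - 1)"
    using graded_part_map[OF assms(1), of "\<lambda>p. div_indet 1 (mod_indet 0 p)" "-1"]
    by (simp add: div_indet_in_forms mod_indet_in_forms)
  show "(\<lambda>a. div_indet 2 (mod_indet 1 (mod_indet 0 (y a)))) \<in> graded_part ds (n - 1)"
    using graded_part_map[OF assms(1), of "\<lambda>p. div_indet 2 (mod_indet 1 (mod_indet 0 p))" "-1"]
    by (simp add: div_indet_in_forms mod_indet_in_forms)
qed (rule irrelevant_decomposition[OF assms(2)])

context resolution
begin

lemma exactD:
  assumes "l \<in> {1..3}" "v \<in> free_module (D l)" "\<And>a. \<phi> l v a = 0"
  obtains u where "u \<in> free_module (D (l + 1))" "\<And>a. v a = \<phi> (l + 1) u a"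
  using exact[OF assms(1,2)] assms(3) by (metis ext)

lemma complex: "l \<in> {1..3} \<Longrightarrow> u \<in> free_module (D (l + 1)) \<Longrightarrow> \<phi> l (\<phi> (l + 1) u) a = 0"
  using exact[of l "\<phi> (l + 1) u"] mat_apply_in_free_module by fastforce

text \<open>This computes \<open>Tor\<^sub>3(A, k)\<close> in two ways: chasing a basis element of \<open>F\<^sub>3\<close> through the double
  complex of the resolution and the Koszul complex yields a socle element of \<open>A\<close> in
  degree \<open>d - 3\<close>.\<close>

lemma last_shift_socle:
  assumes "d \<in> set (D 3)"
  obtains q where "q \<in> forms (d - 3)" "q \<notin> I" "\<And>v. indet v * q \<in> I"
proof -
  obtain b where b: "b < length (D 3)" "D 3 ! b = d" using assms by (auto simp: in_set_conv_nth)
  define e where "e = unit_vec b"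
  have e: "e \<in> graded_part (D 3) d" using unit_vec_graded[OF b(1)] b(2) by (simp add: e_def)
  have gr: "\<phi> 3 v \<in> graded_part (D 2) n" if "v \<in> graded_part (D 3) n" for v n
    using mat_apply_graded[OF graded_\<phi>[of 3] that] by simp
  have gr2: "\<phi> 2 v \<in> graded_part (D 1) n" if "v \<in> graded_part (D 2) n" for v n
    using mat_apply_graded[OF graded_\<phi>[of 2] that] by simp
  have gr1: "\<phi> 1 v \<in> graded_part [0] n" if "v \<in> graded_part (D 1) n" for v n
    using mat_apply_graded[OF graded_\<phi>[of 1] that] by simp
  have cx1: "\<phi> 1 (\<phi> 2 u) a = 0" if "u \<in> graded_part (D 2) n" for u a n
    using complex[of 1 u a] graded_partD(3)[OF that] by (simp add: numeral_2_eq_2)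
  have cx2: "\<phi> 2 (\<phi> 3 u) a = 0" if "u \<in> graded_part (D 3) n" for u a n
    using complex[of 2 u a] graded_partD(3)[OF that] by simp
  obtain u0 u1 u2 where u: "u0 \<in> graded_part (D 2) (d - 1)" "u1 \<in> graded_part (D 2) (d - 1)"
    "u2 \<in> graded_part (D 2) (d - 1)"
    and eu: "\<And>a. \<phi> 3 e a = indet 0 * u0 a + indet 1 * u1 a + indet 2 * u2 a"
    using irrelevant_decomposition_graded[OF gr[OF e]] image_irrelevant[of 3 e] by auto
  \<comment> \<open>The image of \<open>\<phi> 3 e\<close> under \<open>\<phi> 2\<close> is zero,
    which is a Koszul relation among the images of the \<open>u\<close>'s.\<close>
  have "indet 0 * \<phi> 2 u0 a + indet 1 * \<phi> 2 u1 a + indet 2 * \<phi> 2 u2 a = 0" for a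
  proof -
    have "\<phi> 3 e = (\<lambda>a. indet 0 * u0 a + indet 1 * u1 a + indet 2 * u2 a)" using eu by blast
    then show ?thesis using cx2[OF e, of a] by (simp only: mat_apply_add mat_apply_mult)
  qed
  then obtain w0 w1 w2 where w: "w0 \<in> graded_part (D 1) (d - 1 - 1)"
    "w1 \<in> graded_part (D 1) (d - 1 - 1)" "w2 \<in> graded_part (D 1) (d - 1 - 1)"
    and uw: "\<And>a. \<phi> 2 u0 a = indet 1 * w2 a - indet 2 * w1 a"
    "\<And>a. \<phi> 2 u1 a = indet 2 * w0 a - indet 0 * w2 a"
    "\<And>a. \<phi> 2 u2 a = indet 0 * w1 a - indet 1 * w0 a"
    using koszul_exact_2_graded[OF gr2[OF u(1)] gr2[OF u(2)] gr2[OF u(3)]] by blast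
  \<comment> \<open>Applying \<open>\<phi> 1\<close> once more shows that the cross product of the
    indeterminates with the images of the \<open>w\<close>'s vanishes. Each stage of the chase
    lowers the degree by one, from \<open>d\<close> to \<open>d - 3\<close> for
    \<open>q\<close>.\<close>
  have "indet 2 * \<phi> 1 w0 0 - indet 0 * \<phi> 1 w2 0 = 0"
  proof -
    have "\<phi> 2 u1 = (\<lambda>a. indet 2 * w0 a - indet 0 * w2 a)" using uw(2) by blast
    then show ?thesis using cx1[OF u(2), of 0] by (simp only: mat_apply_diff mat_apply_mult)
  qed
  moreover have "indet 0 * \<phi> 1 w1 0 - indet 1 * \<phi> 1 w0 0 = 0"
  proof -
    have "\<phi> 2 u2 = (\<lambda>a. indet 0 * w1 a - indet 1 * w0 a)" using uw(3) by blast
    then show ?thesis using cx1[OF u(3), of 0] by (simp only: mat_apply_diff mat_apply_mult)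
  qed
  moreover define q where "q = div_indet 0 (\<phi> 1 w0 0)"
  ultimately have wq: "\<phi> 1 w0 0 = indet 0 * q" "\<phi> 1 w1 0 = indet 1 * q" "\<phi> 1 w2 0 = indet 2 * q"
    using koszul_exact_1[of "\<phi> 1 w1 0" "\<phi> 1 w0 0" "\<phi> 1 w2 0"] by simp_all
  have "\<phi> 1 w0 0 \<in> forms (d - 1 - 1)"
    using graded_partD(1)[OF gr1[OF w(1)], of 0] by simp
  then have "q \<in> forms (d - 3)" using div_indet_in_forms[of _ "d - 2" 0] by (simp add: q_def)
  moreover have "indet v * q \<in> I" for v
  proof -
    have "v = 0 \<or> v = 1 \<or> v = 2" using UNIV_3 by blast
    moreover have "\<phi> 1 w0 0 \<in> I" "\<phi> 1 w1 0 \<in> I" "\<phi> 1 w2 0 \<in> I"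
      using image_\<phi>_1 graded_partD(3)[OF w(1)] graded_partD(3)[OF w(2)] graded_partD(3)[OF w(3)]
      by blast+
    ultimately show ?thesis using wq by metis
  qed
  moreover have "q \<notin> I"
  proof
    \<comment> \<open>The chase is now run backwards: a preimage \<open>z\<close> of
      \<open>q\<close> corrects the \<open>w\<close>'s, the resulting \<open>y\<close>'s correct the
      \<open>u\<close>'s, and the resulting \<open>s\<close>'s correct \<open>e\<close>.\<close>
    assume "q \<in> I"
    then obtain z where z: "z \<in> free_module (D 1)" "\<phi> 1 z 0 = q" using image_\<phi>_1 by blast
    have lift: "\<exists>y\<in>free_module (D 2). \<forall>a. w a - indet v * z a = \<phi> 2 y a"
      if "w \<in> graded_part (D 1) (d - 1 - 1)" "\<phi> 1 w 0 = indet v * q" for w v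
    proof -
      have "\<phi> 1 (\<lambda>a. w a - indet v * z a) a = 0" for a
        using that(2) z(2)
        by (cases "a = 0") (simp_all add: mat_apply_diff mat_apply_mult mat_apply_out)
      moreover have "(\<lambda>a. w a - indet v * z a) \<in> free_module (D 1)"
        using z(1) graded_partD(3)[OF that(1)] by (simp add: free_module_def)
      ultimately obtain y where "y \<in> free_module (D (1 + 1))"
        "\<And>a. w a - indet v * z a = \<phi> (1 + 1) y a"
        using exactD[of 1 "\<lambda>a. w a - indet v * z a"] by auto
      then show ?thesis unfolding one_add_one by blast
    qed
    obtain y0 where y0: "y0 \<in> free_module (D 2)" "\<And>a. w0 a - indet 0 * z a = \<phi> 2 y0 a"
      using lift[OF w(1) wq(1)] by blast
    obtain y1 where y1: "y1 \<in> free_module (D 2)" "\<And>a. w1 a - indet 1 * z a = \<phi> 2 y1 a"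
      using lift[OF w(2) wq(2)] by blast
    obtain y2 where y2: "y2 \<in> free_module (D 2)" "\<And>a. w2 a - indet 2 * z a = \<phi> 2 y2 a"
      using lift[OF w(3) wq(3)] by blast
    \<comment> \<open>The subtracted term is a component of the cross product of the indeterminates
      with the \<open>y\<close>'s; it has the same image as \<open>u\<close> under
      \<open>\<phi> 2\<close>.\<close>
    have lift: "\<exists>s\<in>free_module (D 3). \<forall>a. u a - (indet i * y a - indet j * x a) = \<phi> 3 s a"
      if "u \<in> free_module (D 2)" "x \<in> free_module (D 2)" "y \<in> free_module (D 2)"
        "\<And>a. \<phi> 2 u a = indet i * \<phi> 2 y a - indet j * \<phi> 2 x a" for u x y i j
    proof -
      have "\<phi> 2 (\<lambda>a. u a - (indet i * y a - indet j * x a)) a = 0" for a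
        using that(4)[of a] by (simp add: mat_apply_diff mat_apply_mult)
      moreover have "(\<lambda>a. u a - (indet i * y a - indet j * x a)) \<in> free_module (D 2)"
        using that(1-3) by (simp add: free_module_def)
      ultimately obtain s where "s \<in> free_module (D (2 + 1))"
        "\<And>a. u a - (indet i * y a - indet j * x a) = \<phi> (2 + 1) s a"
        using exactD[of 2 "\<lambda>a. u a - (indet i * y a - indet j * x a)"] by auto
      then show ?thesis by auto
    qed
    have uy: "\<phi> 2 u0 a = indet 1 * \<phi> 2 y2 a - indet 2 * \<phi> 2 y1 a"
      "\<phi> 2 u1 a = indet 2 * \<phi> 2 y0 a - indet 0 * \<phi> 2 y2 a"
      "\<phi> 2 u2 a = indet 0 * \<phi> 2 y1 a - indet 1 * \<phi> 2 y0 a" for a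
      unfolding uw y0(2)[symmetric] y1(2)[symmetric] y2(2)[symmetric]
      by (simp_all add: algebra_simps)
    note u' = graded_partD(3)[OF u(1)] graded_partD(3)[OF u(2)] graded_partD(3)[OF u(3)]
    obtain s0 where s0: "s0 \<in> free_module (D 3)"
      "\<And>a. u0 a - (indet 1 * y2 a - indet 2 * y1 a) = \<phi> 3 s0 a"
      using lift[OF u'(1) y1(1) y2(1) uy(1)] by blast
    obtain s1 where s1: "s1 \<in> free_module (D 3)"
      "\<And>a. u1 a - (indet 2 * y0 a - indet 0 * y2 a) = \<phi> 3 s1 a"
      using lift[OF u'(2) y2(1) y0(1) uy(2)] by blast
    obtain s2 where s2: "s2 \<in> free_module (D 3)"
      "\<And>a. u2 a - (indet 0 * y1 a - indet 1 * y0 a) = \<phi> 3 s2 a"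
      using lift[OF u'(3) y0(1) y1(1) uy(3)] by blast
    \<comment> \<open>The cross product with the \<open>y\<close>'s is orthogonal to the
      indeterminates, so \<open>e\<close> and \<open>?s\<close> have the same image under the
      injective map \<open>\<phi> 3\<close>. Then the entry 1 of \<open>e\<close> would lie in the
      irrelevant ideal.\<close>
    let ?s = "\<lambda>a. indet 0 * s0 a + indet 1 * s1 a + indet 2 * s2 a"
    have "\<phi> 3 (\<lambda>a. e a - ?s a) = (\<lambda>_. 0)"
      unfolding mat_apply_diff mat_apply_add mat_apply_mult eu
        s0(2)[symmetric] s1(2)[symmetric] s2(2)[symmetric]
      by (simp add: algebra_simps)
    moreover have "(\<lambda>a. e a - ?s a) \<in> free_module (D 3)"
      using graded_partD(3)[OF e] s0(1) s1(1) s2(1) by (simp add: free_module_def)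
    ultimately have "(\<lambda>a. e a - ?s a) = (\<lambda>_. 0)" by (rule inj_\<phi>_3[rotated])
    then have "e b - ?s b = 0" by (rule fun_cong)
    then have "e b = ?s b" by (simp only: right_minus_eq)
    also have "\<dots> \<in> irrelevant_ideal"
      by (intro irrelevant_ideal_add irrelevant_ideal_mult indet_in_irrelevant_ideal)
    finally show False using unit_vec_not_irrelevant by (simp add: e_def)
  qed
  ultimately show ?thesis using that by blast
qed

lemma last_shift_level:
  assumes "level I c" "d \<in> set (D 3)"
  shows "d = int c + 3"
proof (rule ccontr)
  assume d: "d \<noteq> int c + 3"
  obtain q where q: "q \<in> forms (d - 3)" "q \<notin> I" "\<And>v. indet v * q \<in> I"
    using last_shift_socle[OF assms(2)] by blast
  have "p * q \<in> I" if p: "p \<in> irrelevant_ideal" for p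
  proof -
    obtain p0 p1 p2 where "p = indet 0 * p0 + indet 1 * p1 + indet 2 * p2"
      using irrelevant_decomposition[OF p] by blast
    then have "p * q = p0 * (indet 0 * q) + p1 * (indet 1 * q) + p2 * (indet 2 * q)"
      by (simp add: algebra_simps)
    then show ?thesis by (simp only:) (intro I_add I_mult[OF q(3)])
  qed
  then have "residue I q \<in> socle I"
    by (auto simp: socle_def residue_simps(2)[symmetric] residue_simps(5) residue_eq_zero_iff
        mult.commute)
  then obtain q' where q': "q' \<in> forms (int c)" "q - q' \<in> I"
    using assms(1) by (auto simp: level_def quot_part_def residue_eq_iff)
  \<comment> \<open>Levelness makes \<open>q\<close> congruent to a form \<open>q'\<close> of degree
    \<open>c\<close>. In a different degree \<open>q'\<close> contributes nothing, and homogeneity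
    of \<open>I\<close> puts \<open>q\<close> itself into \<open>I\<close>.\<close>
  have "hom_component (d - 3) (q - q') = q"
    using q(1) hom_component_forms_other[OF q'(1), of "d - 3"] d
    by (simp add: hom_component_diff hom_component_forms)
  then show False using homogeneous q'(2) q(2) by (metis homogeneous_ideal_def)
qed

text \<open>If all forms of degree \<open>d - 1\<close> lie in \<open>I\<close>, a generator of
  degree \<open>d\<close> is a combination of elements of \<open>I\<close> with coefficients in the
  irrelevant ideal, which contradicts minimality.\<close>

lemma generator_degree:
  assumes "d \<in> set (D 1)"
  shows "\<not> forms (d - 1) \<subseteq> I"
proof
  assume I: "forms (d - 1) \<subseteq> I"
  obtain b where b: "b < length (D 1)" "D 1 ! b = d" using assms by (auto simp: in_set_conv_nth)
  have e: "unit_vec b \<in> graded_part (D 1) d" using unit_vec_graded[OF b(1)] b(2) by simp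
  have "\<phi> 1 (unit_vec b) \<in> graded_part [0] d"
    using mat_apply_graded[OF graded_\<phi>[of 1] e] by simp
  then obtain q0 q1 q2 where q: "q0 \<in> graded_part [0] (d - 1)" "q1 \<in> graded_part [0] (d - 1)"
    "q2 \<in> graded_part [0] (d - 1)"
    and eq: "\<And>a. \<phi> 1 (unit_vec b) a = indet 0 * q0 a + indet 1 * q1 a + indet 2 * q2 a"
    using irrelevant_decomposition_graded[of _ "[0]" d] image_irrelevant[of 1 "unit_vec b"]
    by (metis (no_types, lifting) atLeastAtMost_iff le_refl one_le_numeral)
  have "q0 0 \<in> I" "q1 0 \<in> I" "q2 0 \<in> I"
    using I q forms_image[of "d - 1"] by blast+
  then obtain u0 u1 u2 where u: "u0 \<in> free_module (D 1)" "u1 \<in> free_module (D 1)"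
    "u2 \<in> free_module (D 1)" "\<phi> 1 u0 0 = q0 0" "\<phi> 1 u1 0 = q1 0" "\<phi> 1 u2 0 = q2 0"
    using image_\<phi>_1 by metis
  let ?s = "\<lambda>a. indet 0 * u0 a + indet 1 * u1 a + indet 2 * u2 a"
  have "\<phi> 1 (\<lambda>a. unit_vec b a - ?s a) a = 0" for a
    using u eq[of 0] by (cases "a = 0")
      (simp_all add: mat_apply_diff mat_apply_add mat_apply_mult mat_apply_out)
  moreover have "(\<lambda>a. unit_vec b a - ?s a) \<in> free_module (D 1)"
    using graded_partD(3)[OF e] u(1-3) by (simp add: free_module_def)
  ultimately have "unit_vec b b - ?s b \<in> irrelevant_ideal"
    using kernel_irrelevant[of 1 "\<lambda>a. unit_vec b a - ?s a" b] by auto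
  moreover have "?s b \<in> irrelevant_ideal"
    by (intro irrelevant_ideal_add irrelevant_ideal_mult indet_in_irrelevant_ideal)
  ultimately have "unit_vec b b \<in> irrelevant_ideal"
    using irrelevant_ideal_add by fastforce
  then show False using unit_vec_not_irrelevant by blast
qed

text \<open>Some entry of a homogeneous preimage in \<open>F_1\<close> is nonzero, so its degree
  \<open>n - d\<close> is not negative. Used to bound the smallest generator degree by
  \<open>t\<close>.\<close>

lemma form_degree_ge_shift:
  assumes "p \<in> I" "p \<in> forms n" "p \<noteq> 0"
  shows "\<exists>d\<in>set (D 1). d \<le> n"
proof -
  obtain v where v: "v \<in> graded_part [0] n" "p = v 0"
    using assms(2) by (auto simp: forms_image[symmetric])
  then have "v \<in> \<phi> 1 ` graded_part (D 1) n"
    using assms(1) image_graded by (simp add: I_part_def)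
  then obtain u where u: "u \<in> graded_part (D 1) n" "\<phi> 1 u 0 = p" using v(2) by blast
  obtain b where "b < length (D 1)" "u b \<noteq> 0"
  proof (rule ccontr)
    assume "\<not> thesis"
    then have "\<forall>b<length (D 1). u b = 0" using that by blast
    then have "\<phi> 1 u 0 = 0" by (simp add: mat_apply_def)
    then show False using assms(3) u(2) by simp
  qed
  then show ?thesis
    using graded_partD(1)[OF u(1), of b] forms_neg[of "u b" "n - D 1 ! b"]
    by (intro bexI[of _ "D 1 ! b"]) force+
qed

lemma last_shifts:
  assumes "level I c" "socle_degree I c"
  shows "set (D 3) = {int c + 3}"
proof -
  have zero: "forms n \<subseteq> I" if "n > int c" for n
    using assms(2) that by (simp add: socle_degree_def quot_part_eq_zero_iff)
  \<comment> \<open>The arguments are left unsimplified to match the terms of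
    \<open>third_diff\<close> at \<open>c + 3\<close>.\<close>
  have "hilb I (int c + 3 - 3) \<noteq> 0"
    using assms(2) by (simp add: socle_degree_def hilb_eq_0_iff[OF proper] quot_part_eq_zero_iff)
  moreover have "hilb I (int c + 3) = 0" "hilb I (int c + 3 - 1) = 0" "hilb I (int c + 3 - 2) = 0"
    using zero by (simp_all add: hilb_eq_0_iff[OF proper])
  ultimately have "third_diff I (int c + 3) < 0" unfolding third_diff_def by linarith
  moreover have "forms (int c + 3 - 1) \<subseteq> I" by (rule zero) simp
  then have "int c + 3 \<notin> set (D 1)" using generator_degree by blast
  then have "betti 1 (int c + 3) = 0" using betti_pos_iff[of 1 "int c + 3"] by simp
  ultimately have "int c + 3 \<in> set (D 3)"
    using third_diff_betti[of "int c + 3"] betti_pos_iff[of 3 "int c + 3"] by auto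
  then show ?thesis using last_shift_level[OF assms(1)] by blast
qed

end

section \<open>Comparison of the shifts with \<open>t\<close>, \<open>i\<close>, \<open>j\<close>
  and \<open>m\<close>\<close>

theorem proposition3p2:
  fixes I :: "'k::field_char_0 poly3 set"
    and c :: nat and e :: nat and t i j m :: int
    and D :: "nat \<Rightarrow> int list" and \<Phi> :: "nat \<Rightarrow> nat \<Rightarrow> nat \<Rightarrow> 'k poly3"
  assumes "homogeneous_ideal I"
    and "I \<inter> forms 1 = {0}"
    and "artinian (quot_alg I)"
    and "socle_degree I c"
    and "level I c"
    and e: "e = (\<Sum>n=0..c. hilb I (int n))"
    and t: "I \<inter> forms t \<noteq> {0}" "\<forall>n<t. I \<inter> forms n = {0}"
    and i: "0 < i" "third_diff I i > 0" "\<forall>n. 0 < n \<and> n < i \<longrightarrow> \<not> third_diff I n > 0"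
    and j: "third_diff I j > 0" "\<forall>n>j. \<not> third_diff I n > 0"
    and m: "m < int c + 3" "third_diff I m < 0"
      "\<forall>n. m < n \<and> n < int c + 3 \<longrightarrow> \<not> third_diff I n < 0"
    and "minimal_resolution I D \<Phi>"
  shows "(real_of_int (t * i * (int c + 3)) / 6 \<le> real e \<longrightarrow>
            real_of_int (min_shift D 1 * min_shift D 2 * min_shift D 3) / 6 \<le> real e) \<and>
         (real e \<le> real_of_int (m * j * (int c + 3)) / 6 \<longrightarrow>
            real e \<le> real_of_int (max_shift D 1 * max_shift D 2 * max_shift D 3) / 6)"
proof -
  interpret homogeneous I by unfold_locales fact
  have "1 \<notin> I"
  proof
    assume "1 \<in> I"
    then have "indet 0 \<in> I \<inter> forms 1" using I_mult[of 1 "indet 0"] indet_in_forms by simp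
    then show False using assms(2) indet_neq_0 by blast
  qed
  then interpret resolution I D \<Phi> using assms by unfold_locales
  have D3: "set (D 3) = {int c + 3}" using assms by (intro last_shifts)
  have pos: "0 < d" if "d \<in> set (D l)" "l \<in> {1..3}" for d l using shift_pos that by blast
  \<comment> \<open>For \<open>n > 0\<close> the indicator of 0 is absent, so \<open>F_2\<close> is
    the only positive contribution.\<close>
  have second: "n \<in> set (D 2)" if "0 < n" "third_diff I n > 0" for n
    using that third_diff_betti[of n] betti_pos_iff[of 2 n] by (simp split: if_splits)
  have "0 \<in> I \<inter> forms t" by simp
  then obtain p where "p \<in> I" "p \<in> forms t" "p \<noteq> 0" using t(1) by blast
  then obtain d where d: "d \<in> set (D 1)" "d \<le> t" using form_degree_ge_shift by blast
  have i2: "i \<in> set (D 2)" using second i by blast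
  \<comment> \<open>This supplies \<open>0 < j\<close>, which the definition of \<open>j\<close>
    does not state.\<close>
  have "i \<le> j" using i(2) j(2) not_le by blast
  then have j2: "j \<in> set (D 2)" using second i(1) j(1) by simp
  have "m \<notin> set (D 3)" using D3 m(1) by simp
  then have m1: "m \<in> set (D 1)"
    using m(2) third_diff_betti[of m] betti_pos_iff[of 1 m] betti_pos_iff[of 3 m]
    by (auto split: if_splits)
  have "min_shift D 1 \<in> set (D 1)" "min_shift D 2 \<in> set (D 2)"
    unfolding min_shift_def using d(1) i2 by (intro Min_in; force)+
  then have "0 < min_shift D 1" "0 < min_shift D 2" using pos[of _ 1] pos[of _ 2] by simp_all
  moreover have "min_shift D 1 \<le> t" "min_shift D 2 \<le> i"
    using order.trans[OF Min_le[of "set (D 1)" d] d(2)] d(1) i2 by (simp_all add: min_shift_def)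
  \<comment> \<open>The third factor is the same on both sides, since \<open>c + 3\<close> is the
    only shift of \<open>F_3\<close> and hence both its minimum and its maximum.\<close>
  ultimately have "min_shift D 1 * min_shift D 2 * (int c + 3) \<le> t * i * (int c + 3)"
    by (intro mult_right_mono mult_mono) auto
  then have a: "min_shift D 1 * min_shift D 2 * min_shift D 3 \<le> t * i * (int c + 3)"
    by (simp add: min_shift_def D3)
  have "m \<le> max_shift D 1" "j \<le> max_shift D 2" "0 < m" "0 < j"
    using m1 j2 pos[of m 1] pos[of j 2] by (auto simp: max_shift_def)
  then have "m * j * (int c + 3) \<le> max_shift D 1 * max_shift D 2 * (int c + 3)"
    by (intro mult_right_mono mult_mono) auto
  then have b: "m * j * (int c + 3) \<le> max_shift D 1 * max_shift D 2 * max_shift D 3"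
    by (simp add: max_shift_def D3)
  have "real_of_int (min_shift D 1 * min_shift D 2 * min_shift D 3) \<le> real_of_int (t * i * (int c + 3))"
    "real_of_int (m * j * (int c + 3)) \<le> real_of_int (max_shift D 1 * max_shift D 2 * max_shift D 3)"
    using a b by (simp_all only: of_int_le_iff)
  then show ?thesis by (intro conjI impI) linarith+
qed

end
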